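(* Let $n\ge 2$ and $y>1$. Let $\sigma$ be a 2-dimensional subspace of the tangent space of $\mathcal H^n$ at $(\mathbf 0,y)\in\mathcal H^n-\{(\mathbf 0,1)\}$ whose angle with the $y$-axis is $\theta$. Then its sectional curvature $\kappa(y,\theta):=\kappa(\sigma)$ is $$\kappa(y,\theta)=\cos^2\theta\;\frac{4y^2(1+3y^2+y^4)}{(1+y^4)^2}+\sin^2\theta\;\frac{2(1+2y^2+4y^4+2y^6+y^8)}{(1+y^4)^2}.$$ This curvature formula is valid for all $1\le y<\infty$. Therefore the sectional curvatures at $(\mathbf 0,y)$ satisfy $0<\kappa_{(\mathbf 0,y)}\le 5$ for all $y\ge1$, and at $y=1$, $\kappa(1,\theta)=5$ gives the maximum curvature over all $y\ge1$.
   Context: Let $J=\mathrm{diag}(-1,\dots,-1,1)$ (of size $n+1$, with $n$ entries $-1$) and let $G=\mathrm{SO}_0(n,1)$ be the identity component of $\{A\in \mathrm{GL}(n+1,\mathbb R): AJA^t=J\}$. Let $K=\mathrm{SO}(n)\times\{1\}\subset G$ (block diagonal). With $e_{ij}$ the elementary matrices, set $E_{ij}=\epsilon_{ij}e_{ij}+e_{ji}$ for $1\le i<j\le n+1$, where $\epsilon_{ij}=-1$ if $j<n+1$ and $\epsilon_{ij}=1$ if $j=n+1$. Give $G$ the left-invariant Riemannian metric for which $\{E_{ij}\}$ is orthonormal at the identity. $K$ acts on $G$ by left multiplication, freely, properly and isometrically, and $\mathcal H^n=K\backslash G=\mathrm{SO}(n)\backslash\mathrm{SO}_0(n,1)$ carries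 the unique Riemannian metric making $G\to K\backslash G$ a Riemannian submersion. Global coordinates: let $N_i=E_{i,n}+E_{i,n+1}$ ($1\le i\le n-1$) and $A_1=E_{n,n+1}$. The map $\varphi(\mathbf x,y)=e^{\sum_{i=1}^{n-1}x_iN_i}e^{\ln(y)A_1}$, $(\mathbf x,y)\in\mathbb R^{n-1}\times\mathbb R^+$, composed with the projection $G\to K\backslash G$ is a diffeomorphism $\mathbb R^{n-1}\times\mathbb R^+\to\mathcal H^n$, by which points of $\mathcal H^n$ are written $(\mathbf x,y)$. The $y$-axis is $\{\mathbf 0\}\times\mathbb R^+$; the angle of $\sigma$ with the $y$-axis is the angle, in the metric of $\mathcal H^n$, between $\sigma$ and the tangent vector $\frac{\partial}{\partial y}$ at $(\mathbf 0,y)$ (so $\theta=0$ means $\frac{\partial}{\partial y}\in\sigma$ and $\theta=\frac\pi2$ means $\sigma\perp\frac{\partial}{\partial y}$). When $n=2$ only $\theta=0$ occurs. *)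

theory Defs
  imports "HOL-Analysis.Analysis"
begin

section \<open>Riemannian geometry in a global chart\<close>

primrec times_cont_diff_on ::
    "nat \<Rightarrow> 'a::euclidean_space set \<Rightarrow> ('a \<Rightarrow> real) \<Rightarrow> bool" where
  "times_cont_diff_on 0 S f \<longleftrightarrow> continuous_on S f"
| "times_cont_diff_on (Suc k) S f \<longleftrightarrow>
     (\<forall>p\<in>S. f differentiable (at p)) \<and>
     (\<forall>v. times_cont_diff_on k S (\<lambda>p. frechet_derivative f (at p) v))"

definition smooth_fun_on :: "'a::euclidean_space set \<Rightarrow> ('a \<Rightarrow> real) \<Rightarrow> bool" where
  "smooth_fun_on S f \<longleftrightarrow> (\<forall>k. times_cont_diff_on k S f)"

text \<open>All tangent spaces of an open set \<open>S\<close> of \<open>'a\<close> are identified with \<open>'a\<close>; \<open>g p u v\<close> is the inner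
  product of the tangent vectors \<open>u\<close>, \<open>v\<close> at \<open>p\<close>. Values of \<open>g\<close> outside \<open>S\<close> are irrelevant.\<close>

definition riemannian_metric_on ::
    "'a::euclidean_space set \<Rightarrow> ('a \<Rightarrow> 'a \<Rightarrow> 'a \<Rightarrow> real) \<Rightarrow> bool" where
  "riemannian_metric_on S g \<longleftrightarrow> open S \<and>
     (\<forall>p\<in>S. bilinear (g p) \<and> (\<forall>u v. g p u v = g p v u) \<and> (\<forall>u. u \<noteq> 0 \<longrightarrow> 0 < g p u u)) \<and>
     (\<forall>u v. smooth_fun_on S (\<lambda>p. g p u v))"

text \<open>\<open>christoffel g p u v\<close> is \<open>\<nabla>\<^sub>u v\<close> at \<open>p\<close> for the Levi-Civita connection, where \<open>u\<close> and \<open>v\<close> are extended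
  to vector fields that are constant in the chart. For such fields all Lie brackets in the Koszul
  formula vanish.\<close>

definition christoffel ::
    "('a \<Rightarrow> 'a \<Rightarrow> 'a \<Rightarrow> real) \<Rightarrow> 'a::euclidean_space \<Rightarrow> 'a \<Rightarrow> 'a \<Rightarrow> 'a" where
  "christoffel g p u v = (THE z. \<forall>w. 2 * g p z w =
      frechet_derivative (\<lambda>q. g q v w) (at p) u
    + frechet_derivative (\<lambda>q. g q u w) (at p) v
    - frechet_derivative (\<lambda>q. g q u v) (at p) w)"

text \<open>\<open>R(u,v)w = \<nabla>\<^sub>u \<nabla>\<^sub>v w - \<nabla>\<^sub>v \<nabla>\<^sub>u w\<close> for fields \<open>u\<close>, \<open>v\<close>, \<open>w\<close> constant in the chart.\<close>

definition riemann_curvature ::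
    "('a \<Rightarrow> 'a \<Rightarrow> 'a \<Rightarrow> real) \<Rightarrow> 'a::euclidean_space \<Rightarrow> 'a \<Rightarrow> 'a \<Rightarrow> 'a \<Rightarrow> 'a" where
  "riemann_curvature g p u v w =
      frechet_derivative (\<lambda>q. christoffel g q v w) (at p) u
    - frechet_derivative (\<lambda>q. christoffel g q u w) (at p) v
    + christoffel g p u (christoffel g p v w)
    - christoffel g p v (christoffel g p u w)"

definition sectional_curvature ::
    "('a \<Rightarrow> 'a \<Rightarrow> 'a \<Rightarrow> real) \<Rightarrow> 'a::euclidean_space \<Rightarrow> 'a set \<Rightarrow> real" where
  "sectional_curvature g p \<sigma> = (THE k. \<exists>u v. span {u, v} = \<sigma> \<and>
     k = g p (riemann_curvature g p u v v) u / (g p u u * g p v v - (g p u v)\<^sup>2))"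

definition metric_angle ::
    "('a \<Rightarrow> 'a \<Rightarrow> 'a \<Rightarrow> real) \<Rightarrow> 'a::euclidean_space \<Rightarrow> 'a \<Rightarrow> 'a \<Rightarrow> real" where
  "metric_angle g p u v = arccos (g p u v / (sqrt (g p u u) * sqrt (g p v v)))"

text \<open>The angle between a vector and a subspace is the least angle with a nonzero vector of it.\<close>

definition subspace_angle ::
    "('a \<Rightarrow> 'a \<Rightarrow> 'a \<Rightarrow> real) \<Rightarrow> 'a::euclidean_space \<Rightarrow> 'a set \<Rightarrow> 'a \<Rightarrow> real" where
  "subspace_angle g p \<sigma> v = (INF u\<in>\<sigma> - {0}. metric_angle g p u v)"


section \<open>The group and its left-invariant metric\<close>

text \<open>The index set \<open>{1, \<dots>, n + 1}\<close> with \<open>n = CARD('m) + 1\<close>: the indices \<open>Co i\<close> stand for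
  \<open>1, \<dots>, n - 1\<close>, \<open>Pen\<close> for \<open>n\<close> and \<open>Last\<close> for \<open>n + 1\<close>. As types are nonempty, \<open>n \<ge> 2\<close>.\<close>

datatype 'm idx = Co 'm | Pen | Last

instance idx :: (finite) finite
proof
  have "(UNIV :: 'a idx set) = insert Pen (insert Last (range Co))"
    by (auto intro: idx.exhaust)
  then show "finite (UNIV :: 'a idx set)"
    by (metis finite finite_imageI finite_insert)
qed

instantiation idx :: (linorder) linorder
begin

fun less_eq_idx :: "'a idx \<Rightarrow> 'a idx \<Rightarrow> bool" where
  "less_eq_idx (Co i) (Co j) \<longleftrightarrow> i \<le> j"
| "less_eq_idx (Co i) Pen \<longleftrightarrow> True"
| "less_eq_idx Pen (Co i) \<longleftrightarrow> False"
| "less_eq_idx Pen Pen \<longleftrightarrow> True"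
| "less_eq_idx i Last \<longleftrightarrow> True"
| "less_eq_idx Last (Co i) \<longleftrightarrow> False"
| "less_eq_idx Last Pen \<longleftrightarrow> False"

definition less_idx :: "'a idx \<Rightarrow> 'a idx \<Rightarrow> bool" where
  "less_idx i j \<longleftrightarrow> i \<le> j \<and> \<not> j \<le> i"

instance
proof
  fix x y z :: "'a idx"
  show "x < y \<longleftrightarrow> x \<le> y \<and> \<not> y \<le> x" by (rule less_idx_def)
  show "x \<le> x" by (cases x) auto
  show "x \<le> y \<Longrightarrow> y \<le> z \<Longrightarrow> x \<le> z" by (cases x; cases y; cases z) auto
  show "x \<le> y \<Longrightarrow> y \<le> x \<Longrightarrow> x = y" by (cases x; cases y) auto
  show "x \<le> y \<or> y \<le> x" by (cases x; cases y) auto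
qed

end

type_synonym 'm sqmat = "real ^ 'm idx ^ 'm idx"

definition Jmat :: "'m::finite sqmat" where
  "Jmat = (\<chi> i j. if i = j then (if i = Last then 1 else -1) else 0)"

definition SO0 :: "'m::finite sqmat set" where
  "SO0 = connected_component_set {A. invertible A \<and> A ** Jmat ** transpose A = Jmat} (mat 1)"

text \<open>\<open>SO(n) \<times> {1}\<close>: a block diagonal matrix with blocks \<open>B\<close> and \<open>1\<close> is orthogonal of determinant 1 iff
  \<open>B\<close> is.\<close>

definition Kgrp :: "'m::finite sqmat set" where
  "Kgrp = {A. orthogonal_matrix A \<and> det A = 1 \<and> A $ Last $ Last = 1 \<and>
              (\<forall>i. i \<noteq> Last \<longrightarrow> A $ i $ Last = 0 \<and> A $ Last $ i = 0)}"

definition elem_mat :: "'m::finite idx \<Rightarrow> 'm idx \<Rightarrow> 'm sqmat" where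
  "elem_mat i j = (\<chi> a b. if a = i \<and> b = j then 1 else 0)"

definition Emat :: "'m::finite idx \<Rightarrow> 'm idx \<Rightarrow> 'm sqmat" where
  "Emat i j = (if j = Last then 1 else -1) *\<^sub>R elem_mat i j + elem_mat j i"

definition Ebasis :: "'m::{finite,linorder} sqmat set" where
  "Ebasis = {Emat i j | i j. i < j}"

text \<open>The tangent space \<open>A \<cdot> so(n,1)\<close> of the group at \<open>A\<close>, where \<open>so(n,1)\<close> is spanned by the \<open>E\<^sub>i\<^sub>j\<close>, and the
  left-invariant metric for which the \<open>E\<^sub>i\<^sub>j\<close> are orthonormal at the identity.\<close>

definition tangent_SO0 :: "'m::{finite,linorder} sqmat \<Rightarrow> 'm sqmat set" where
  "tangent_SO0 A = (\<lambda>X. A ** X) ` span Ebasis"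

definition lie_inner :: "'m::{finite,linorder} sqmat \<Rightarrow> 'm sqmat \<Rightarrow> real" where
  "lie_inner X Y = (\<Sum>b\<in>Ebasis. representation Ebasis X b * representation Ebasis Y b)"

definition left_inv_metric ::
    "'m::{finite,linorder} sqmat \<Rightarrow> 'm sqmat \<Rightarrow> 'm sqmat \<Rightarrow> real" where
  "left_inv_metric A U V = lie_inner (matrix_inv A ** U) (matrix_inv A ** V)"


section \<open>The quotient and its coordinates\<close>

text \<open>The arithmetic type classes act componentwise on \<open>real ^ 'n ^ 'n\<close>, so powers for the matrix
  product \<open>**\<close> are iterated explicitly.\<close>

definition mat_exp :: "real ^ 'n ^ 'n \<Rightarrow> real ^ 'n ^ 'n" where
  "mat_exp A = (\<Sum>k. (1 / fact k) *\<^sub>R (((\<lambda>B. A ** B) ^^ k) (mat 1)))"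

definition Nmat :: "'m::finite \<Rightarrow> 'm sqmat" where
  "Nmat i = Emat (Co i) Pen + Emat (Co i) Last"

definition Amat :: "'m::finite sqmat" where
  "Amat = Emat Pen Last"

type_synonym 'm coords = "(real ^ 'm) \<times> real"

definition chart_dom :: "'m::finite coords set" where
  "chart_dom = {p. 0 < snd p}"

definition chart_map :: "'m::finite coords \<Rightarrow> 'm sqmat" where
  "chart_map p = mat_exp (\<Sum>i\<in>UNIV. (fst p $ i) *\<^sub>R Nmat i) ** mat_exp (ln (snd p) *\<^sub>R Amat)"

definition K_orbit :: "'m::finite sqmat \<Rightarrow> 'm sqmat set" where
  "K_orbit A = {k ** A | k. k \<in> Kgrp}"

text \<open>The projection \<open>G \<rightarrow> K\G\<close> read in the coordinates \<open>(x, y)\<close>.\<close>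

definition quot_proj :: "'m::finite sqmat \<Rightarrow> 'm coords" where
  "quot_proj A = inv_into chart_dom (\<lambda>p. K_orbit (chart_map p)) (K_orbit A)"

text \<open>\<open>D\<close> is only determined on \<open>tangent_SO0 A\<close>, where it is the differential of the projection; \<open>H\<close> is the
  horizontal space, i.e. the orthogonal complement of its kernel.\<close>

definition quot_riemannian_submersion ::
    "('m::{finite,linorder} coords \<Rightarrow> 'm coords \<Rightarrow> 'm coords \<Rightarrow> real) \<Rightarrow> bool" where
  "quot_riemannian_submersion g \<longleftrightarrow> (\<forall>A\<in>SO0. \<exists>D.
     (quot_proj has_derivative D) (at A within SO0) \<and>
     D ` tangent_SO0 A = UNIV \<and>
     (let H = {U \<in> tangent_SO0 A. \<forall>V\<in>tangent_SO0 A. D V = 0 \<longrightarrow> left_inv_metric A U V = 0}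
      in \<forall>U\<in>H. \<forall>V\<in>H. g (quot_proj A) (D U) (D V) = left_inv_metric A U V))"

definition is_quotient_metric ::
    "('m::{finite,linorder} coords \<Rightarrow> 'm coords \<Rightarrow> 'm coords \<Rightarrow> real) \<Rightarrow> bool" where
  "is_quotient_metric g \<longleftrightarrow> riemannian_metric_on chart_dom g \<and> quot_riemannian_submersion g"

end

theory Submission
  imports Defs
begin

text \<open>Left multiplication by \<open>SO(n) \<times> {1}\<close> does not change the last row of a matrix, and two matrices of
  \<open>SO0\<close> with the same last row differ by such a multiplication. The last rows of \<open>SO0\<close> are the
  points of one sheet of a hyperboloid, so the quotient is this hyperboloid. The chart coordinates
  of a coset are linear functions of the last row \<open>v\<close>; the projection is therefore the restriction
  of a linear map to the group (\<open>quot_proj_eq\<close>), and so is its differential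
  (\<open>quot_proj_derivative\<close>).

  A tangent vector \<open>A ** X\<close> moves the last row by the product of \<open>v\<close> and \<open>X\<close>. For \<open>X\<close> in the Lie
  algebra, \<open>X ** Jmat\<close> is a skew matrix, and the inner product of the Lie algebra is half of the
  Euclidean one. Among the \<open>X\<close> that move \<open>v\<close> by \<open>h\<close> the shortest comes from the skew matrix that
  maps \<open>v\<close> to \<open>jflip h\<close> and kills the orthogonal complement of both; its squared length is 
  \<open>h \<bullet> h / v \<bullet> v\<close>. Hence the quotient metric is the restriction of the conformally flat metric 
  \<open>dv \<bullet> dv / v \<bullet> v\<close> to the hyperboloid (\<open>quotient_metric_formula\<close>).

  This metric is invariant under rotations about the point \<open>(0, 1)\<close>. With \<open>r\<close> the distance to this
  point, which is \<open>ln y\<close> at \<open>(0, y)\<close> for \<open>y \<ge> 1\<close>, it is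
  \<open>dr\<^sup>2 + f(r)\<^sup>2 d\<omega>\<^sup>2\<close> for \<open>f(r) = sinh r / sqrt (cosh (2 r))\<close>, which predicts the two curvatures:
  \<open>- f'' / f\<close> for planes that contain the radial direction and \<open>(1 - f'\<^sup>2) / f\<^sup>2\<close> for planes
  orthogonal to it (\<open>kappa_rad\<close> and \<open>kappa_tan\<close>). In the given chart this is verified by a direct
  computation at the points \<open>(0, y)\<close>, for which \<open>metric_riemann_curvature\<close> expresses the curvature
  tensor by two derivatives of the metric and products of Christoffel symbols, and \<open>curvature_axis\<close>
  is the result: the curvature tensor of a pair of vectors is a combination of its squared area
  orthogonal to the axis and the remaining part of its squared area. Since \<open>cos\<^sup>2\<close> and \<open>sin\<^sup>2\<close> of
  the angle are the two proportions of the squared area, the formula of the theorem follows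
  (\<open>sectional_curvature_plane\<close>). The bounds hold since both curvatures differ from \<open>5\<close> by a square
  times a positive factor: \<open>(y\<^sup>2 - 1)\<^sup>2\<close> divides the numerator of the difference.\<close>

section \<open>Curvature in a chart from the metric coefficients\<close>

lemma has_derivative_of_frechet:
  "f differentiable (at p) \<Longrightarrow> (f has_derivative frechet_derivative f (at p)) (at p)"
  using frechet_derivative_works by blast

lemma metric_open: "riemannian_metric_on S g \<Longrightarrow> open S"
  by (simp add: riemannian_metric_on_def)

lemma metric_bilinear: "riemannian_metric_on S g \<Longrightarrow> p \<in> S \<Longrightarrow> bilinear (g p)"
  by (simp add: riemannian_metric_on_def)

lemma metric_sym: "riemannian_metric_on S g \<Longrightarrow> p \<in> S \<Longrightarrow> g p u v = g p v u"
  by (simp add: riemannian_metric_on_def)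

lemma metric_pos: "riemannian_metric_on S g \<Longrightarrow> p \<in> S \<Longrightarrow> u \<noteq> 0 \<Longrightarrow> 0 < g p u u"
  by (simp add: riemannian_metric_on_def)

lemma metric_differentiable:
  assumes "riemannian_metric_on S g" "p \<in> S"
  shows "(\<lambda>q. g q u v) differentiable (at p)"
proof -
  have "times_cont_diff_on (Suc 0) S (\<lambda>p. g p u v)"
    using assms unfolding riemannian_metric_on_def smooth_fun_on_def by blast
  then show ?thesis using assms(2) by simp
qed

lemma metric_derivative_differentiable:
  assumes "riemannian_metric_on S g" "p \<in> S"
  shows "(\<lambda>q. frechet_derivative (\<lambda>q. g q u v) (at q) w) differentiable (at p)"
proof -
  have "times_cont_diff_on (Suc (Suc 0)) S (\<lambda>p. g p u v)"
    using assms unfolding riemannian_metric_on_def smooth_fun_on_def by blast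
  then show ?thesis using assms(2) by simp
qed

lemma metric_derivative_sym:
  assumes g: "riemannian_metric_on S g" and p: "p \<in> S"
  shows "frechet_derivative (\<lambda>q. g q u v) (at p) = frechet_derivative (\<lambda>q. g q v u) (at p)"
  by (rule frechet_derivative_transform_within_open
        [OF metric_differentiable[OF g p] metric_open[OF g] p])
     (rule metric_sym[OF g])

text \<open>The first claim is linearity in the direction of differentiation, the second one in a slot of the
  metric.\<close>

lemma metric_derivative_linear:
  assumes g: "riemannian_metric_on S g" and p: "p \<in> S"
  shows "linear (frechet_derivative (\<lambda>q. g q u v) (at p))"
    and "linear (\<lambda>v. frechet_derivative (\<lambda>q. g q u v) (at p) w)"
proof -
  show "linear (frechet_derivative (\<lambda>q. g q u v) (at p))"
    using metric_differentiable[OF g p] by (rule linear_frechet_derivative)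
  have D: "((\<lambda>q. g q u v) has_derivative frechet_derivative (\<lambda>q. g q u v) (at p)) (at p)" for v
    by (rule has_derivative_of_frechet[OF metric_differentiable[OF g p]])
  show "linear (\<lambda>v. frechet_derivative (\<lambda>q. g q u v) (at p) w)"
  proof (rule linearI)
    fix v v'
    have "((\<lambda>q. g q u (v + v')) has_derivative
        (\<lambda>w. frechet_derivative (\<lambda>q. g q u v) (at p) w + frechet_derivative (\<lambda>q. g q u v') (at p) w))
        (at p)"
      by (rule has_derivative_transform_within_open[OF has_derivative_add[OF D D] metric_open[OF g] p])
         (simp add: bilinear_radd[OF metric_bilinear[OF g]])
    from frechet_derivative_at[OF this]
    show "frechet_derivative (\<lambda>q. g q u (v + v')) (at p) w =
        frechet_derivative (\<lambda>q. g q u v) (at p) w + frechet_derivative (\<lambda>q. g q u v') (at p) w"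
      by (rule fun_cong[symmetric])
  next
    fix c :: real and v
    have "((\<lambda>q. g q u (c *\<^sub>R v)) has_derivative
        (\<lambda>w. c *\<^sub>R frechet_derivative (\<lambda>q. g q u v) (at p) w)) (at p)"
      by (rule has_derivative_transform_within_open[OF has_derivative_scaleR_right[OF D] metric_open[OF g] p])
         (simp add: bilinear_rmul[OF metric_bilinear[OF g]])
    from frechet_derivative_at[OF this]
    show "frechet_derivative (\<lambda>q. g q u (c *\<^sub>R v)) (at p) w =
        c *\<^sub>R frechet_derivative (\<lambda>q. g q u v) (at p) w"
      by (rule fun_cong[symmetric])
  qed
qed

text \<open>The Christoffel symbols of the first kind: first derivatives of the metric that represent the
  connection through the metric.\<close>

definition koszul ::
    "('a \<Rightarrow> 'a \<Rightarrow> 'a \<Rightarrow> real) \<Rightarrow> 'a::euclidean_space \<Rightarrow> 'a \<Rightarrow> 'a \<Rightarrow> 'a \<Rightarrow> real" where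
  "koszul g p u v w =
    (frechet_derivative (\<lambda>q. g q v w) (at p) u
     + frechet_derivative (\<lambda>q. g q u w) (at p) v
     - frechet_derivative (\<lambda>q. g q u v) (at p) w) / 2"

lemma linear_koszul:
  assumes g: "riemannian_metric_on S g" and p: "p \<in> S"
  shows "linear (koszul g p u v)"
proof -
  note l = metric_derivative_linear[OF g p]
  show ?thesis
    unfolding koszul_def
    by (rule linearI)
       (simp_all add: linear_add[OF l(1)] linear_add[OF l(2)] linear_cmul[OF l(1)] linear_cmul[OF l(2)]
         field_simps)
qed

lemma koszul_differentiable:
  assumes g: "riemannian_metric_on S g" and p: "p \<in> S"
  shows "(\<lambda>q. koszul g q u v w) differentiable (at p)"
  unfolding koszul_def
  by (intro differentiable_add differentiable_diff differentiable_divide differentiable_const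
      metric_derivative_differentiable[OF g p]) simp

text \<open>Metric compatibility of the connection, written with Christoffel symbols of the first kind.\<close>

lemma metric_derivative_eq_koszul:
  assumes g: "riemannian_metric_on S g" and p: "p \<in> S"
  shows "frechet_derivative (\<lambda>q. g q v w) (at p) u = koszul g p u v w + koszul g p u w v"
  unfolding koszul_def
  by (simp add: metric_derivative_sym[OF g p, of w v] field_simps)

text \<open>Pairing with the standard basis turns a definite form into an injective linear endomorphism. Its
  surjectivity yields representing vectors, and its inverse bounds a vector by its pairings.\<close>

lemma bilinear_form_Basis_coeffs:
  fixes B :: "'a::euclidean_space \<Rightarrow> 'a \<Rightarrow> real"
  assumes B: "bilinear B" and pos: "\<And>u. u \<noteq> 0 \<Longrightarrow> 0 < B u u"
  shows "linear (\<lambda>z. \<Sum>b\<in>Basis. B z b *\<^sub>R b)" "inj (\<lambda>z. \<Sum>b\<in>Basis. B z b *\<^sub>R b)"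
proof -
  show l: "linear (\<lambda>z. \<Sum>b\<in>Basis. B z b *\<^sub>R b)"
    by (rule linearI)
       (simp_all add: bilinear_ladd[OF B] bilinear_lmul[OF B] scaleR_left_distrib sum.distrib
         scaleR_sum_right)
  have "z = 0" if "(\<Sum>b\<in>Basis. B z b *\<^sub>R b) = 0" for z
  proof (rule ccontr)
    assume "z \<noteq> 0"
    have "B z b = 0" if "b \<in> Basis" for b
      using arg_cong[OF \<open>(\<Sum>b\<in>Basis. B z b *\<^sub>R b) = 0\<close>, of "\<lambda>x. x \<bullet> b"] that by simp
    then have "B z (\<Sum>b\<in>Basis. (z \<bullet> b) *\<^sub>R b) = 0"
      using B by (simp add: linear_sum bilinear_def linear_cmul)
    then show False
      using pos[OF \<open>z \<noteq> 0\<close>] by (simp add: euclidean_representation)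
  qed
  then show "inj (\<lambda>z. \<Sum>b\<in>Basis. B z b *\<^sub>R b)"
    using linear_injective_0[OF l] by blast
qed

lemma bilinear_form_representation:
  fixes B :: "'a::euclidean_space \<Rightarrow> 'a \<Rightarrow> real"
  assumes B: "bilinear B" and pos: "\<And>u. u \<noteq> 0 \<Longrightarrow> 0 < B u u" and f: "linear f"
  shows "\<exists>z. \<forall>w. B z w = f w"
proof -
  have "surj (\<lambda>z. \<Sum>b\<in>Basis. B z b *\<^sub>R b)"
    by (rule linear_injective_imp_surjective) (use bilinear_form_Basis_coeffs[OF B pos] in auto)
  then obtain z where z: "(\<Sum>b\<in>Basis. f b *\<^sub>R b) = (\<Sum>b\<in>Basis. B z b *\<^sub>R b)"
    unfolding surj_def by blast
  have "B z b = f b" if "b \<in> Basis" for b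
    using arg_cong[OF z, of "\<lambda>x. x \<bullet> b"] that by simp
  moreover have "linear (B z)" using B by (simp add: bilinear_def)
  ultimately have "B z = f"
    using f linear_eq_stdbasis by blast
  then show ?thesis by blast
qed

text \<open>Definiteness of the metric makes the description in the definition of \<open>christoffel\<close> unique, finite
  dimension makes it satisfiable.\<close>

lemma metric_christoffel:
  assumes g: "riemannian_metric_on S g" and p: "p \<in> S"
  shows "g p (christoffel g p u v) w = koszul g p u v w"
proof -
  have *: "(2 * g p z w =
      frechet_derivative (\<lambda>q. g q v w) (at p) u
    + frechet_derivative (\<lambda>q. g q u w) (at p) v
    - frechet_derivative (\<lambda>q. g q u v) (at p) w) \<longleftrightarrow> g p z w = koszul g p u v w" for z w
    unfolding koszul_def by (auto simp: field_simps)
  have "\<exists>!z. \<forall>w. g p z w = koszul g p u v w"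
  proof (rule ex_ex1I)
    show "\<exists>z. \<forall>w. g p z w = koszul g p u v w"
      by (rule bilinear_form_representation[OF metric_bilinear[OF g p] _ linear_koszul[OF g p]])
         (rule metric_pos[OF g p])
    fix z z' assume "\<forall>w. g p z w = koszul g p u v w" "\<forall>w. g p z' w = koszul g p u v w"
    then have "g p (z - z') (z - z') = 0"
      by (simp add: bilinear_lsub[OF metric_bilinear[OF g p]])
    then show "z = z'" using metric_pos[OF g p, of "z - z'"] by fastforce
  qed
  from theI'[OF this] show ?thesis unfolding christoffel_def * by blast
qed

text \<open>Near \<open>p\<close> the error is at most half of \<open>d\<close>, so \<open>d\<close> is at most twice \<open>f\<close>, which is of order \<open>q - p\<close>.
  Then the error is of order \<open>\<omega>\<close> times \<open>q - p\<close>, and \<open>d\<close> has the same derivative as \<open>f\<close>.\<close>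

lemma differentiable_of_self_bound:
  fixes f d :: "'a::euclidean_space \<Rightarrow> 'b::euclidean_space"
  assumes f: "f differentiable (at p)" "f p = 0" and d: "d p = 0"
    and w: "(\<omega> \<longlongrightarrow> (0::real)) (at p)"
    and bd: "eventually (\<lambda>q. norm (d q - f q) \<le> \<omega> q * norm (d q)) (at p)"
  shows "d differentiable (at p)"
proof -
  obtain f' where f': "(f has_derivative f') (at p)" using f differentiable_def by blast
  have lim: "((\<lambda>q. norm (f q - f' (q - p)) / norm (q - p)) \<longlongrightarrow> 0) (at p)"
    using f' f(2) by (simp add: has_derivative_iff_norm)
  obtain C where C: "C > 0" "\<And>x. norm (f' x) \<le> norm x * C"
    using bounded_linear.pos_bounded[OF has_derivative_bounded_linear[OF f']] by blast
  let ?H = "\<lambda>q. norm (f q - f' (q - p)) / norm (q - p) +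
      2 * \<bar>\<omega> q\<bar> * (norm (f q - f' (q - p)) / norm (q - p) + C)"
  have lim2: "(?H \<longlongrightarrow> 0) (at p)"
    by (rule tendsto_eq_intros lim w tendsto_rabs | simp)+
  have "eventually (\<lambda>q. \<bar>\<omega> q\<bar> < 1/2) (at p)"
    using w[unfolded tendsto_iff, rule_format, of "1/2"] by simp
  with bd have ev: "eventually (\<lambda>q. norm (norm (d q - d p - f' (q - p)) / norm (q - p)) \<le> ?H q) (at p)"
  proof eventually_elim
    case (elim q)
    have "norm (d q) \<le> norm (f q) + norm (d q - f q)"
      using norm_triangle_sub by blast
    also have "norm (d q - f q) \<le> 1/2 * norm (d q)"
      using elim(1,2) by (smt (verit, best) mult_right_mono norm_ge_zero)
    finally have dq: "norm (d q) \<le> 2 * norm (f q)" by simp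
    have fq: "norm (f q) \<le> norm (f q - f' (q - p)) + norm (q - p) * C"
      using C(2)[of "q - p"] norm_triangle_sub[of "f q" "f' (q - p)"] by linarith
    have "norm (d q - f q) \<le> \<bar>\<omega> q\<bar> * norm (d q)"
      using elim(1) by (smt (verit, best) mult_right_mono norm_ge_zero)
    also have "\<dots> \<le> \<bar>\<omega> q\<bar> * (2 * (norm (f q - f' (q - p)) + norm (q - p) * C))"
      using dq fq by (intro mult_left_mono) auto
    finally have "norm (d q - f' (q - p)) \<le> norm (f q - f' (q - p)) +
        2 * \<bar>\<omega> q\<bar> * (norm (f q - f' (q - p)) + norm (q - p) * C)"
      using norm_triangle_ineq[of "d q - f q" "f q - f' (q - p)"] by (simp add: algebra_simps)
    then have "norm (d q - f' (q - p)) / norm (q - p) \<le> (norm (f q - f' (q - p)) +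
        2 * \<bar>\<omega> q\<bar> * (norm (f q - f' (q - p)) + norm (q - p) * C)) / norm (q - p)"
      by (rule divide_right_mono) simp
    also have "\<dots> = (norm (f q - f' (q - p)) / norm (q - p)) + 2 * \<bar>\<omega> q\<bar> *
        (norm (f q - f' (q - p)) / norm (q - p) + (norm (q - p) / norm (q - p)) * C)"
      by (cases "q = p") (simp_all add: field_simps)
    also have "\<dots> \<le> ?H q"
      by (cases "q = p") (use C in \<open>auto intro!: mult_left_mono\<close>)
    finally show ?case using d by simp
  qed
  have "((\<lambda>q. norm (d q - d p - f' (q - p)) / norm (q - p)) \<longlongrightarrow> 0) (at p)"
    by (rule Lim_null_comparison[OF ev lim2])
  then have "(d has_derivative f') (at p)"
    using has_derivative_bounded_linear[OF f'] by (simp add: has_derivative_iff_norm)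
  then show ?thesis using differentiable_def by blast
qed

text \<open>A linear system whose matrix and right-hand side depend differentiably on the parameter. Freezing
  the matrix at \<open>p\<close> changes the equation for the increment of the solution only by a term that is
  small compared with the increment itself, so that \<open>differentiable_of_self_bound\<close> applies.\<close>

lemma representing_vector_differentiable:
  fixes g :: "'a::euclidean_space \<Rightarrow> 'a \<Rightarrow> 'a \<Rightarrow> real"
  assumes S: "open S" "p \<in> S"
    and bil: "\<And>q. q \<in> S \<Longrightarrow> bilinear (g q)"
    and pos: "\<And>u. u \<noteq> 0 \<Longrightarrow> 0 < g p u u"
    and dg: "\<And>u v. (\<lambda>q. g q u v) differentiable (at p)"
    and df: "\<And>w. (\<lambda>q. f q w) differentiable (at p)"
    and rep: "\<And>q w. q \<in> S \<Longrightarrow> g q (\<gamma> q) w = f q w"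
  shows "\<gamma> differentiable (at p)"
proof -
  define T where "T z = (\<Sum>b\<in>Basis. g p z b *\<^sub>R b)" for z
  have T: "linear T" "inj T"
    using bilinear_form_Basis_coeffs[OF bil[OF S(2)] pos] unfolding T_def by auto
  obtain T' where T': "linear T'" "\<And>z. T' (T z) = z"
    using linear_injective_left_inverse[OF T] by (metis comp_apply id_apply)
  define d where "d q = \<gamma> q - \<gamma> p" for q
  define e where "e q = T' (\<Sum>b\<in>Basis. (f q b - g q (\<gamma> p) b) *\<^sub>R b)" for q
  \<comment> \<open>operator norm bound for the change of the matrix, composed with the inverse of the frozen one\<close>
  define \<omega> where "\<omega> q = (\<Sum>b\<in>Basis. (\<Sum>c\<in>Basis. \<bar>g q c b - g p c b\<bar>) * norm (T' b))" for q
  have "e differentiable (at p)"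
    unfolding e_def
    by (rule differentiable_compose[where f = T'])
       (use T'(1) linear_imp_differentiable in blast,
        intro differentiable_sum ballI differentiable_scaleR differentiable_diff df dg differentiable_const finite_Basis)
  moreover have "e p = 0"
    unfolding e_def using rep[OF S(2)] linear_0[OF T'(1)] by simp
  moreover have "d p = 0" by (simp add: d_def)
  moreover have "(\<omega> \<longlongrightarrow> 0) (at p)"
  proof -
    have "((\<lambda>q. g q c b) \<longlongrightarrow> g p c b) (at p)" for b c
      using differentiable_imp_continuous_within[OF dg] by (simp add: continuous_within)
    then have "((\<lambda>q. \<bar>g q c b - g p c b\<bar>) \<longlongrightarrow> 0) (at p)" for b c
      by (metis LIM_zero tendsto_rabs_zero)
    then show ?thesis
      unfolding \<omega>_def by (auto intro!: tendsto_null_sum tendsto_mult_left_zero)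
  qed
  moreover have "eventually (\<lambda>q. norm (d q - e q) \<le> \<omega> q * norm (d q)) (at p)"
    using eventually_at_in_open'[OF S]
  proof eventually_elim
    case (elim q)
    let ?h = "\<lambda>b. g p (d q) b - g q (d q) b"
    have "d q - e q = T' (T (d q)) - e q" by (simp add: T')
    also have "\<dots> = T' (T (d q) - (\<Sum>b\<in>Basis. (f q b - g q (\<gamma> p) b) *\<^sub>R b))"
      by (simp add: e_def linear_diff[OF T'(1)])
    also have "T (d q) - (\<Sum>b\<in>Basis. (f q b - g q (\<gamma> p) b) *\<^sub>R b) = (\<Sum>b\<in>Basis. ?h b *\<^sub>R b)"
      unfolding T_def d_def rep[OF elim, symmetric]
      by (simp add: bilinear_lsub[OF bil[OF elim]] sum_subtractf sum.distrib algebra_simps)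
    finally have "d q - e q = (\<Sum>b\<in>Basis. ?h b *\<^sub>R T' b)"
      by (simp add: linear_sum[OF T'(1)] linear_cmul[OF T'(1)])
    then have "norm (d q - e q) \<le> (\<Sum>b\<in>Basis. \<bar>?h b\<bar> * norm (T' b))"
      by (simp only:) (rule order.trans[OF norm_sum], simp)
    also have "\<dots> \<le> (\<Sum>b\<in>Basis. ((\<Sum>c\<in>Basis. \<bar>g q c b - g p c b\<bar>) * norm (d q)) * norm (T' b))"
    proof (intro sum_mono mult_right_mono)
      fix b :: 'a
      have ex: "g r (d q) b = (\<Sum>c\<in>Basis. (d q \<bullet> c) * g r c b)" if "r \<in> S" for r
      proof -
        have l: "linear (\<lambda>z. g r z b)" using bil[OF that] by (simp add: bilinear_def)
        have "g r (d q) b = g r (\<Sum>c\<in>Basis. (d q \<bullet> c) *\<^sub>R c) b"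
          by (simp add: euclidean_representation)
        also have "\<dots> = (\<Sum>c\<in>Basis. (d q \<bullet> c) * g r c b)"
          by (simp add: linear_sum[OF l] linear_cmul[OF l])
        finally show ?thesis .
      qed
      have "\<bar>?h b\<bar> = \<bar>\<Sum>c\<in>Basis. (d q \<bullet> c) * (g p c b - g q c b)\<bar>"
        by (simp add: ex[OF S(2)] ex[OF elim] sum_subtractf algebra_simps)
      also have "\<dots> \<le> (\<Sum>c\<in>Basis. \<bar>(d q \<bullet> c) * (g p c b - g q c b)\<bar>)" by (rule sum_abs)
      also have "\<dots> \<le> (\<Sum>c\<in>Basis. norm (d q) * \<bar>g q c b - g p c b\<bar>)"
        by (intro sum_mono) (auto simp: abs_mult abs_minus_commute Basis_le_norm intro!: mult_mono)
      finally show "\<bar>?h b\<bar> \<le> (\<Sum>c\<in>Basis. \<bar>g q c b - g p c b\<bar>) * norm (d q)"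
        by (simp add: sum_distrib_left[symmetric] mult.commute)
    qed simp
    also have "\<dots> = \<omega> q * norm (d q)"
      unfolding \<omega>_def sum_distrib_right by (simp add: mult_ac)
    finally show ?case .
  qed
  ultimately have "d differentiable (at p)"
    by (rule differentiable_of_self_bound)
  then have "(\<lambda>q. d q + \<gamma> p) differentiable (at p)"
    by (intro differentiable_add differentiable_const)
  then show ?thesis by (simp add: d_def)
qed

lemma christoffel_differentiable:
  assumes g: "riemannian_metric_on S g" and p: "p \<in> S"
  shows "(\<lambda>q. christoffel g q u v) differentiable (at p)"
  by (rule representing_vector_differentiable[where f = "\<lambda>q. koszul g q u v",
        OF metric_open[OF g] p metric_bilinear[OF g] metric_pos[OF g p]
          metric_differentiable[OF g p] koszul_differentiable[OF g p] metric_christoffel[OF g]])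

text \<open>The product rule for \<open>g (\<gamma>, z)\<close> with a moving vector \<open>\<gamma>\<close>, where \<open>g (\<gamma>, z)\<close> is a Christoffel symbol
  of the first kind.\<close>

lemma metric_derivative_christoffel:
  assumes g: "riemannian_metric_on S g" and p: "p \<in> S"
  shows "g p (frechet_derivative (\<lambda>q. christoffel g q v w) (at p) u) z =
    frechet_derivative (\<lambda>q. koszul g q v w z) (at p) u
    - frechet_derivative (\<lambda>q. g q (christoffel g p v w) z) (at p) u"
proof -
  define \<gamma> where "\<gamma> q = christoffel g q v w" for q
  define \<gamma>' where "\<gamma>' = frechet_derivative \<gamma> (at p)"
  have d\<gamma>: "(\<gamma> has_derivative \<gamma>') (at p)"
    unfolding \<gamma>'_def \<gamma>_def
    by (rule has_derivative_of_frechet[OF christoffel_differentiable[OF g p]])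
  have ex: "g q x z = (\<Sum>b\<in>Basis. (x \<bullet> b) * g q b z)" if "q \<in> S" for q x
  proof -
    have l: "linear (\<lambda>x. g q x z)" using metric_bilinear[OF g that] by (simp add: bilinear_def)
    have "g q x z = g q (\<Sum>c\<in>Basis. (x \<bullet> c) *\<^sub>R c) z" by (simp add: euclidean_representation)
    also have "\<dots> = (\<Sum>b\<in>Basis. (x \<bullet> b) * g q b z)"
      by (simp add: linear_sum[OF l] linear_cmul[OF l])
    finally show ?thesis .
  qed
  have Db: "((\<lambda>q. g q b z) has_derivative frechet_derivative (\<lambda>q. g q b z) (at p)) (at p)" for b
    by (rule has_derivative_of_frechet[OF metric_differentiable[OF g p]])
  have "((\<lambda>q. \<Sum>b\<in>Basis. (\<gamma> q \<bullet> b) * g q b z) has_derivative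
      (\<lambda>u. \<Sum>b\<in>Basis. (\<gamma> p \<bullet> b) * frechet_derivative (\<lambda>q. g q b z) (at p) u + (\<gamma>' u \<bullet> b) * g p b z)) (at p)"
    by (intro has_derivative_sum has_derivative_mult has_derivative_inner_left d\<gamma> Db)
  then have "((\<lambda>q. koszul g q v w z) has_derivative
      (\<lambda>u. \<Sum>b\<in>Basis. (\<gamma> p \<bullet> b) * frechet_derivative (\<lambda>q. g q b z) (at p) u + (\<gamma>' u \<bullet> b) * g p b z)) (at p)"
    by (rule has_derivative_transform_within_open[OF _ metric_open[OF g] p])
       (simp add: ex[symmetric] \<gamma>_def metric_christoffel[OF g])
  from fun_cong[OF frechet_derivative_at[OF this], of u]
  have 1: "frechet_derivative (\<lambda>q. koszul g q v w z) (at p) u =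
      (\<Sum>b\<in>Basis. (\<gamma> p \<bullet> b) * frechet_derivative (\<lambda>q. g q b z) (at p) u) + g p (\<gamma>' u) z"
    unfolding sum.distrib ex[OF p, of "\<gamma>' u"] by (rule sym)
  have "((\<lambda>q. \<Sum>b\<in>Basis. (\<gamma> p \<bullet> b) * g q b z) has_derivative
      (\<lambda>u. \<Sum>b\<in>Basis. (\<gamma> p \<bullet> b) * frechet_derivative (\<lambda>q. g q b z) (at p) u)) (at p)"
    by (intro has_derivative_sum has_derivative_mult_right Db)
  then have "((\<lambda>q. g q (\<gamma> p) z) has_derivative
      (\<lambda>u. \<Sum>b\<in>Basis. (\<gamma> p \<bullet> b) * frechet_derivative (\<lambda>q. g q b z) (at p) u)) (at p)"
    by (rule has_derivative_transform_within_open[OF _ metric_open[OF g] p]) (simp add: ex[symmetric])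
  from frechet_derivative_at[OF this]
  have 2: "frechet_derivative (\<lambda>q. g q (\<gamma> p) z) (at p) u =
      (\<Sum>b\<in>Basis. (\<gamma> p \<bullet> b) * frechet_derivative (\<lambda>q. g q b z) (at p) u)"
    by (rule fun_cong[symmetric])
  show ?thesis using 1 2 unfolding \<gamma>'_def \<gamma>_def by simp
qed

text \<open>Metric compatibility turns the terms in which the metric is differentiated into products of two
  Christoffel symbols. One half of these cancels against the quadratic terms in the definition of
  the curvature; what remains are derivatives of symbols of the first kind, which are explicit, and
  Christoffel symbols at the single point \<open>p\<close>.\<close>

lemma metric_riemann_curvature:
  assumes g: "riemannian_metric_on S g" and p: "p \<in> S"
  shows "g p (riemann_curvature g p u v w) z =
      frechet_derivative (\<lambda>q. koszul g q v w z) (at p) u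
    - frechet_derivative (\<lambda>q. koszul g q u w z) (at p) v
    - g p (christoffel g p u z) (christoffel g p v w)
    + g p (christoffel g p v z) (christoffel g p u w)"
  unfolding riemann_curvature_def
  by (simp add: bilinear_ladd[OF metric_bilinear[OF g p]] bilinear_lsub[OF metric_bilinear[OF g p]]
      metric_derivative_christoffel[OF g p] metric_derivative_eq_koszul[OF g p]
      metric_christoffel[OF g p])

section \<open>The Lorentz group\<close>

lemma UNIV_idx: "(UNIV :: 'm idx set) = insert Pen (insert Last (range Co))"
  by (auto intro: idx.exhaust)

lemma sum_idx:
  fixes f :: "'m::finite idx \<Rightarrow> 'b::comm_monoid_add"
  shows "(\<Sum>k\<in>UNIV. f k) = (\<Sum>i\<in>UNIV. f (Co i)) + f Pen + f Last"
proof -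
  have "inj (Co :: 'm \<Rightarrow> 'm idx)" by (auto intro: injI)
  then have "(\<Sum>k\<in>range Co. f k) = (\<Sum>i\<in>UNIV. f (Co i))"
    by (simp add: sum.reindex)
  then show ?thesis
    unfolding UNIV_idx by (subst sum.insert; (subst sum.insert)?) (auto simp: ac_simps)
qed

lemma forall_idx: "(\<forall>k. P k) \<longleftrightarrow> (\<forall>i. P (Co i)) \<and> P Pen \<and> P Last"
  by (metis idx.exhaust)

lemma inner_idx:
  fixes v w :: "real ^ 'm::finite idx"
  shows "v \<bullet> w = (\<Sum>i\<in>UNIV. v $ Co i * w $ Co i) + v $ Pen * w $ Pen + v $ Last * w $ Last"
  by (simp add: inner_vec_def sum_idx)

definition sgnJ :: "'m idx \<Rightarrow> real" where
  "sgnJ k = (if k = Last then 1 else -1)"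

lemma sgnJ_square [simp]: "sgnJ k * sgnJ k = 1" by (simp add: sgnJ_def)

text \<open>\<open>v \<bullet> jflip w\<close> is the Lorentz form, positive on the axis \<open>Last\<close>.\<close>

definition jflip :: "real ^ 'm::finite idx \<Rightarrow> real ^ 'm idx" where
  "jflip v = (\<chi> k. sgnJ k * v $ k)"

lemma jflip_nth [simp]: "jflip v $ k = sgnJ k * v $ k" by (simp add: jflip_def)

lemma jflip_linear: "linear jflip"
  by (rule linearI) (simp_all add: vec_eq_iff algebra_simps)

lemmas jflip_simps = linear_add[OF jflip_linear] linear_diff[OF jflip_linear]
  linear_cmul[OF jflip_linear] linear_0[OF jflip_linear] linear_neg[OF jflip_linear]

lemma jflip_axis [simp]: "jflip (axis k c) = axis k (sgnJ k * c)"
  by (simp add: vec_eq_iff axis_def)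

lemma inner_jflip_left: "jflip v \<bullet> w = v \<bullet> jflip w"
  by (simp add: inner_vec_def mult_ac)

lemma row_mult: "(A ** B) $ a = (\<Sum>k\<in>UNIV. A $ a $ k *\<^sub>R B $ k)"
  by (simp add: vec_eq_iff matrix_matrix_mult_def)

definition Lor :: "'m::finite sqmat set" where
  "Lor = {A. A ** Jmat ** transpose A = Jmat}"

text \<open>The entries of \<open>A ** Jmat ** transpose A\<close> are the Lorentz products of the rows of \<open>A\<close>, so
  membership can be checked row by row.\<close>

lemma Lor_iff_rows: "A \<in> Lor \<longleftrightarrow> (\<forall>a b. A $ a \<bullet> jflip (A $ b) = (if a = b then sgnJ a else 0))"
proof -
  have 1: "(A ** Jmat) $ a $ k = A $ a $ k * sgnJ k" for a k
  proof -
    have "(A ** Jmat) $ a $ k = (\<Sum>j\<in>UNIV. A $ a $ j * Jmat $ j $ k)"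
      by (simp add: matrix_matrix_mult_def)
    also have "\<dots> = (\<Sum>j\<in>UNIV. if j = k then A $ a $ k * sgnJ k else 0)"
      by (rule sum.cong) (auto simp: Jmat_def sgnJ_def)
    finally have "(A ** Jmat) $ a $ k = (\<Sum>j\<in>UNIV. if j = k then A $ a $ k * sgnJ k else 0)" .
    then show ?thesis by simp
  qed
  have "(A ** Jmat ** transpose A) $ a $ b = A $ a \<bullet> jflip (A $ b)" for a b
  proof -
    have "(A ** Jmat ** transpose A) $ a $ b = (\<Sum>k\<in>UNIV. (A ** Jmat) $ a $ k * A $ b $ k)"
      by (simp add: matrix_matrix_mult_def[of "A ** Jmat"] transpose_def)
    also have "\<dots> = A $ a \<bullet> jflip (A $ b)"
      by (simp add: 1 inner_vec_def mult_ac)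
    finally show ?thesis .
  qed
  moreover have "Jmat $ a $ b = (if a = b then sgnJ a else 0)" for a b :: "'a idx"
    by (simp add: Jmat_def sgnJ_def)
  ultimately show ?thesis unfolding Lor_def by (simp add: vec_eq_iff)
qed

lemma Lor_mult:
  assumes "A \<in> Lor" "B \<in> Lor"
  shows "A ** B \<in> Lor"
proof -
  have "(A ** B) ** Jmat ** transpose (A ** B) = A ** (B ** Jmat ** transpose B) ** transpose A"
    by (simp add: matrix_transpose_mul matrix_mul_assoc)
  then show ?thesis using assms by (simp add: Lor_def)
qed

lemma Jmat_square: "Jmat ** Jmat = mat 1"
proof -
  have "(Jmat ** Jmat) $ i $ j = (mat 1 :: 'a sqmat) $ i $ j" for i j :: "'a idx"
  proof -
    have "(Jmat ** Jmat) $ i $ j = (\<Sum>k\<in>UNIV. if k = i then if i = j then 1 else 0 else (0::real))"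
      unfolding matrix_matrix_mult_def by (simp only: vec_lambda_beta) (rule sum.cong, auto simp: Jmat_def)
    then show ?thesis by (simp add: mat_def)
  qed
  then show ?thesis by (simp add: vec_eq_iff)
qed

lemma Lor_inverse:
  assumes "A \<in> Lor"
  shows "A ** (Jmat ** transpose A ** Jmat) = mat 1" "(Jmat ** transpose A ** Jmat) ** A = mat 1"
    "invertible A" "Jmat ** transpose A ** Jmat \<in> Lor"
proof -
  show 1: "A ** (Jmat ** transpose A ** Jmat) = mat 1"
    using assms Jmat_square by (simp add: Lor_def matrix_mul_assoc)
  then show 2: "(Jmat ** transpose A ** Jmat) ** A = mat 1"
    using matrix_left_right_inverse by blast
  show "invertible A" using 1 invertible_right_inverse by blast
  let ?B = "Jmat ** transpose A ** Jmat"
  have "Jmat ** (Jmat ** transpose A ** Jmat ** A) = Jmat" using 2 by simp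
  then have *: "transpose A ** Jmat ** A = Jmat"
    by (simp add: matrix_mul_assoc Jmat_square)
  have tJ: "transpose Jmat = (Jmat :: 'a sqmat)"
    by (simp add: vec_eq_iff transpose_def Jmat_def)
  have "?B ** Jmat ** transpose ?B = Jmat ** transpose A ** (Jmat ** Jmat) ** Jmat ** A ** Jmat"
    by (simp add: matrix_transpose_mul tJ matrix_mul_assoc)
  also have "\<dots> = Jmat ** (transpose A ** Jmat ** A) ** Jmat"
    unfolding Jmat_square by (simp add: matrix_mul_assoc)
  also have "\<dots> = Jmat" unfolding * by (simp add: Jmat_square)
  finally have "?B ** Jmat ** transpose ?B = Jmat" .
  then show "?B \<in> Lor" by (simp add: Lor_def)
qed

lemma mat_1_Lor: "mat 1 \<in> Lor"
  by (simp add: Lor_def transpose_mat)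

lemma SO0_eq_component_Lor: "SO0 = connected_component_set Lor (mat 1)"
proof -
  have "{A. invertible A \<and> A ** Jmat ** transpose A = Jmat} = (Lor :: 'a sqmat set)"
    using Lor_inverse(3) by (auto simp: Lor_def)
  then show ?thesis by (simp add: SO0_def)
qed

lemma SO0_Lor: "A \<in> SO0 \<Longrightarrow> A \<in> Lor"
  unfolding SO0_eq_component_Lor using connected_component_subset by blast

lemma mat_1_SO0: "mat 1 \<in> SO0"
  unfolding SO0_eq_component_Lor using mat_1_Lor by (simp add: connected_component_refl)

text \<open>The tool to show membership in the identity component: a connected family in the full group that
  meets \<open>SO0\<close> stays in it.\<close>

lemma SO0_connected_image:
  assumes c: "continuous_on T c" "connected T" and L: "\<And>t. t \<in> T \<Longrightarrow> c t \<in> Lor"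
    and s: "s \<in> T" "c s \<in> SO0" and t: "t \<in> T"
  shows "c t \<in> SO0"
proof -
  have "c ` T \<subseteq> connected_component_set Lor (c s)"
    by (rule connected_component_maximal) (use assms connected_continuous_image in auto)
  also have "\<dots> = SO0"
    using s(2) unfolding SO0_eq_component_Lor by (metis connected_component_eq)
  finally show ?thesis using t by blast
qed

lemma positive_on_SO0:
  assumes "continuous_on SO0 f" "f (mat 1) > (0::real)" "\<And>B. B \<in> SO0 \<Longrightarrow> f B \<noteq> 0" "A \<in> SO0"
  shows "f A > 0"
proof (rule ccontr)
  assume "\<not> f A > 0"
  have "connected (SO0 :: 'a sqmat set)" unfolding SO0_eq_component_Lor by (rule connected_connected_component)
  then have "connected (f ` SO0)" using assms(1) connected_continuous_image by blast
  from connectedD_interval[OF this, of "f A" "f (mat 1)" 0]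
  show False using \<open>\<not> f A > 0\<close> assms(2-4) mat_1_SO0 by force
qed

lemma continuous_on_matrix_mult:
  fixes f g :: "'b::topological_space \<Rightarrow> real ^ 'n ^ 'n"
  assumes "continuous_on S f" "continuous_on S g"
  shows "continuous_on S (\<lambda>x. f x ** g x)"
  unfolding matrix_matrix_mult_def
  by (intro continuous_intros continuous_on_vec_lambda assms)

text \<open>The determinant is \<open>1\<close> or \<open>-1\<close> on the full group and \<open>1\<close> at the identity.\<close>

lemma SO0_det:
  assumes "A \<in> SO0"
  shows "det A = 1"
proof -
  have sq: "(det B)^2 = 1" if "B \<in> SO0" for B :: "'a sqmat"
  proof -
    have "B ** Jmat ** transpose B = Jmat" using SO0_Lor[OF that] by (simp add: Lor_def)
    then have "det B * det (Jmat :: 'a sqmat) * det B = det (Jmat :: 'a sqmat)"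
      by (metis det_mul det_transpose)
    moreover have "det (Jmat :: 'a sqmat) \<noteq> 0"
      using Jmat_square by (metis det_I det_mul mult_zero_left zero_neq_one)
    ultimately show ?thesis by (simp add: power2_eq_square)
  qed
  have "det A > 0"
  proof (rule positive_on_SO0[OF _ _ _ assms])
    show "continuous_on SO0 (det :: 'a sqmat \<Rightarrow> real)"
      unfolding det_def by (intro continuous_intros)
    show "det (mat 1 :: 'a sqmat) > 0" by simp
    show "det B \<noteq> 0" if "B \<in> SO0" for B :: "'a sqmat" using sq[OF that] by auto
  qed
  then show ?thesis using sq[OF assms] by (simp add: power2_eq_1_iff)
qed

lemma Lor_last_row:
  assumes "A \<in> Lor"
  shows "A $ Last $ Last ^ 2 = 1 + (\<Sum>i\<in>UNIV. (A $ Last $ Co i)^2) + (A $ Last $ Pen)^2"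
proof -
  have "A $ Last \<bullet> jflip (A $ Last) = 1"
    using assms unfolding Lor_iff_rows by (simp add: sgnJ_def)
  then show ?thesis
    by (simp add: inner_idx sgnJ_def power2_eq_square sum_negf)
qed

text \<open>The last row lies on the hyperboloid, where the last entry has absolute value at least \<open>1\<close>; so
  connectedness selects the sheet of \<open>mat 1\<close>.\<close>

lemma SO0_last_pos:
  assumes "A \<in> SO0"
  shows "A $ Last $ Last > 0"
proof (rule positive_on_SO0[OF _ _ _ assms])
  show "continuous_on SO0 (\<lambda>A :: 'a sqmat. A $ Last $ Last)" by (intro continuous_intros)
  show "(mat 1 :: 'a sqmat) $ Last $ Last > 0" by (simp add: mat_def)
  fix B :: "'a sqmat" assume "B \<in> SO0"
  have "0 \<le> (\<Sum>i\<in>UNIV. (B $ Last $ Co i)^2) + (B $ Last $ Pen)^2"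
    by (simp add: sum_nonneg)
  then have "(B $ Last $ Last)^2 \<ge> 1"
    using Lor_last_row[OF SO0_Lor[OF \<open>B \<in> SO0\<close>]] by linarith
  then show "B $ Last $ Last \<noteq> 0" by auto
qed

section \<open>Cosets and the last row\<close>

lemma Kgrp_last_row: "C \<in> Kgrp \<Longrightarrow> C $ Last = axis Last 1"
  unfolding Kgrp_def by (auto simp: vec_eq_iff axis_def)

lemma Kgrp_mult:
  assumes "C \<in> Kgrp" "C' \<in> Kgrp"
  shows "C ** C' \<in> Kgrp"
proof -
  have r: "(C ** C') $ a $ b = (\<Sum>k\<in>UNIV. C $ a $ k * C' $ k $ b)" for a b
    by (simp add: matrix_matrix_mult_def)
  have "(C ** C') $ Last $ b = C' $ Last $ b" for b
    unfolding r using Kgrp_last_row[OF assms(1)]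
    by (simp add: axis_def if_distrib[of "\<lambda>x. x * _"] cong: if_cong)
  moreover have "C' $ k $ Last = (if k = Last then 1 else 0)" for k
    using assms(2) by (auto simp: Kgrp_def)
  then have "(C ** C') $ a $ Last = C $ a $ Last" for a
    unfolding r by (simp add: if_distrib[of "\<lambda>x. _ * x"] cong: if_cong)
  ultimately show ?thesis
    using assms unfolding Kgrp_def by (auto simp: orthogonal_matrix_mul det_mul)
qed

lemma K_orbit_subsetI:
  assumes "C \<in> Kgrp" "A = C ** B"
  shows "K_orbit A \<subseteq> K_orbit B"
  unfolding K_orbit_def using Kgrp_mult[OF _ assms(1)] assms(2) by (auto simp: matrix_mul_assoc)

lemma mat_1_Kgrp: "mat 1 \<in> Kgrp"
  by (simp add: Kgrp_def orthogonal_matrix_id) (simp add: mat_def)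

lemma K_orbit_last_row:
  assumes "K_orbit A = K_orbit B"
  shows "A $ Last = B $ Last"
proof -
  have "A \<in> K_orbit A" unfolding K_orbit_def using mat_1_Kgrp by force
  then obtain C where C: "C \<in> Kgrp" "A = C ** B" using assms unfolding K_orbit_def by auto
  have "A $ Last = (\<Sum>k\<in>UNIV. C $ Last $ k *\<^sub>R B $ k)" unfolding C(2) row_mult ..
  also have "\<dots> = B $ Last"
    unfolding Kgrp_last_row[OF C(1)] by (simp add: axis_def if_distrib[of "\<lambda>x. x *\<^sub>R _"] cong: if_cong)
  finally show ?thesis .
qed

text \<open>The quotient \<open>C\<close> of two matrices with equal last rows has the last row of the identity. Lorentz
  orthogonality of the other rows to it forces the block form, and on the complement of the axis
  \<open>Last\<close> the Lorentz form is minus the Euclidean one.\<close>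

lemma same_last_row_imp_Kgrp_factor:
  assumes A: "A \<in> SO0" and B: "B \<in> SO0" and eq: "A $ Last = B $ Last"
  obtains C where "C \<in> Kgrp" "A = C ** B"
proof -
  define B' where "B' = Jmat ** transpose B ** Jmat"
  note B' = Lor_inverse[OF SO0_Lor[OF B], folded B'_def]
  define C where "C = A ** B'"
  have CB: "A = C ** B"
    unfolding C_def by (metis B'(2) matrix_mul_assoc matrix_mul_rid)
  have C: "C \<in> Lor" unfolding C_def by (rule Lor_mult[OF SO0_Lor[OF A] B'(4)])
  have "C $ Last = (B ** B') $ Last" unfolding C_def row_mult eq ..
  then have last: "C $ Last $ k = (if k = Last then 1 else 0)" for k
    unfolding B'(1) by (auto simp: mat_def)
  have col: "C $ a $ Last = 0" if "a \<noteq> Last" for a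
  proof -
    have "C $ Last = axis Last 1" using last by (simp add: vec_eq_iff axis_def)
    then have "C $ a \<bullet> jflip (C $ Last) = C $ a $ Last" by (simp add: inner_axis sgnJ_def)
    then show ?thesis using C that unfolding Lor_iff_rows by simp
  qed
  have rows: "C $ a \<bullet> C $ b = (if a = b then 1 else 0)" for a b
  proof (cases "a = Last \<or> b = Last")
    case True
    have "C $ Last = axis Last 1" using last by (simp add: vec_eq_iff axis_def)
    with True col show ?thesis by (auto simp: inner_axis inner_axis' axis_nth)
  next
    case False
    then have "jflip (C $ b) = - C $ b" using col by (auto simp: vec_eq_iff sgnJ_def)
    moreover have "C $ a \<bullet> jflip (C $ b) = (if a = b then -1 else 0)"
      using C False unfolding Lor_iff_rows by (simp add: sgnJ_def)
    ultimately show ?thesis by (auto split: if_splits)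
  qed
  have "C ** transpose C = mat 1"
    using rows by (simp add: vec_eq_iff matrix_matrix_mult_def transpose_def inner_vec_def mat_def)
  then have "orthogonal_matrix C"
    unfolding orthogonal_matrix_def using matrix_left_right_inverse by blast
  moreover have "det C = 1"
    using SO0_det[OF A] SO0_det[OF B] unfolding CB det_mul by simp
  ultimately have "C \<in> Kgrp" using last col by (simp add: Kgrp_def)
  then show ?thesis using that CB by blast
qed

lemma K_orbit_eq_iff:
  assumes "A \<in> SO0" "B \<in> SO0"
  shows "K_orbit A = K_orbit B \<longleftrightarrow> A $ Last = B $ Last"
proof
  assume eq: "A $ Last = B $ Last"
  obtain C where "C \<in> Kgrp" "A = C ** B" by (rule same_last_row_imp_Kgrp_factor[OF assms eq])
  moreover obtain C' where "C' \<in> Kgrp" "B = C' ** A"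
    by (rule same_last_row_imp_Kgrp_factor[OF assms(2,1) eq[symmetric]])
  ultimately show "K_orbit A = K_orbit B" by (intro subset_antisym K_orbit_subsetI)
qed (rule K_orbit_last_row)

section \<open>The chart\<close>

lemma bilinear_matrix_mult: "bilinear (\<lambda>A B :: real ^ 'n ^ 'n. A ** B)"
  unfolding bilinear_def linear_iff
  by (simp add: vec_eq_iff matrix_matrix_mult_def sum.distrib sum_distrib_left algebra_simps)

lemmas matrix_mult_simps =
  bilinear_ladd[OF bilinear_matrix_mult] bilinear_radd[OF bilinear_matrix_mult]
  bilinear_lsub[OF bilinear_matrix_mult] bilinear_rsub[OF bilinear_matrix_mult]
  bilinear_lmul[OF bilinear_matrix_mult] bilinear_rmul[OF bilinear_matrix_mult]
  bilinear_lzero[OF bilinear_matrix_mult] bilinear_rzero[OF bilinear_matrix_mult]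

lemma mat_exp_nilpotent:
  fixes A :: "real ^ 'n ^ 'n"
  assumes "A ** (A ** A) = 0"
  shows "mat_exp A = mat 1 + A + (1 / 2) *\<^sub>R (A ** A)"
proof -
  have z: "((\<lambda>B. A ** B) ^^ k) (mat 1) = 0" if "k \<ge> 3" for k
  proof -
    have k: "k = Suc (Suc (Suc (k - 3)))" using that by simp
    have "A ** (A ** (A ** B)) = 0" for B :: "real ^ 'n ^ 'n"
      using arg_cong[OF assms, of "\<lambda>M. M ** B"] by (simp add: matrix_mul_assoc matrix_mult_simps)
    then show ?thesis by (subst k) (simp only: funpow.simps comp_apply)
  qed
  have "mat_exp A = (\<Sum>k\<in>{..<3}. (1 / fact k) *\<^sub>R ((\<lambda>B. A ** B) ^^ k) (mat 1))"
    unfolding mat_exp_def by (rule suminf_finite) (auto simp: z)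
  then show ?thesis by (simp add: eval_nat_numeral)
qed

text \<open>For \<open>A\<^sup>3 = A\<close> the matrices \<open>(A\<^sup>2 + A) / 2\<close> and \<open>(A\<^sup>2 - A) / 2\<close> are the spectral projections for
  the eigenvalues \<open>1\<close> and \<open>-1\<close>, and \<open>mat 1 - A ** A\<close> is the one for \<open>0\<close>.\<close>

lemma mat_exp_boost:
  fixes A :: "real ^ 'n ^ 'n"
  assumes "A ** (A ** A) = A"
  shows "mat_exp (t *\<^sub>R A) = (mat 1 - A ** A) + (exp t / 2) *\<^sub>R (A ** A + A) + (exp (- t) / 2) *\<^sub>R (A ** A - A)"
proof -
  define P where "P = A ** A"
  have AP: "A ** P = A" using assms by (simp add: P_def)
  define f where "f = (\<lambda>B :: real ^ 'n ^ 'n. t *\<^sub>R A ** B)"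
  have f: "f B = t *\<^sub>R (A ** B)" for B by (simp add: f_def matrix_mult_simps)
  have pow: "(f ^^ k) (mat 1) =
      (if k = 0 then mat 1 - P else 0) + (t ^ k / 2) *\<^sub>R (P + A) + ((- t) ^ k / 2) *\<^sub>R (P - A)" for k
  proof (induction k)
    case 0
    show ?case by (simp add: vec_eq_iff field_simps)
  next
    case (Suc k)
    have A0: "A ** (if k = 0 then mat 1 - P else 0) = 0"
      by (simp_all add: matrix_mult_simps AP P_def[symmetric])
    have "(f ^^ Suc k) (mat 1) = t *\<^sub>R (A ** ((f ^^ k) (mat 1)))" by (simp add: f)
    also have "\<dots> = t *\<^sub>R ((t ^ k / 2) *\<^sub>R (P + A) + ((- t) ^ k / 2) *\<^sub>R (- (P - A)))"
      unfolding Suc.IH matrix_mult_simps(2,4,6) A0 AP P_def[symmetric] by (simp add: algebra_simps)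
    finally show ?case by (simp add: algebra_simps)
  qed
  have s1: "(\<lambda>k. (if k = 0 then mat 1 - P else 0)) sums (mat 1 - P)"
    using sums_single[of 0 "\<lambda>_. mat 1 - P"] by simp
  have s2: "(\<lambda>k. (x ^ k /\<^sub>R fact k) *\<^sub>R M) sums (exp x *\<^sub>R M)" for x :: real and M :: "real ^ 'n ^ 'n"
    by (rule sums_scaleR_left[OF exp_converges])
  have "(1 / fact k) *\<^sub>R (f ^^ k) (mat 1) =
      (if k = 0 then mat 1 - P else 0) + (t ^ k /\<^sub>R fact k) *\<^sub>R ((1/2) *\<^sub>R (P + A))
      + ((- t) ^ k /\<^sub>R fact k) *\<^sub>R ((1/2) *\<^sub>R (P - A))" for k
  proof -
    have X: "(1 / fact k) *\<^sub>R (if k = 0 then mat 1 - P else 0) = (if k = 0 then mat 1 - P else 0)"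
      by simp
    have c: "1 / fact k * (s / 2) = (s /\<^sub>R fact k) * (1 / 2)" for s :: real
      by (simp add: field_simps)
    show ?thesis unfolding pow scaleR_add_right[of "1 / fact k"] X scaleR_scaleR c ..
  qed
  then have "(\<lambda>k. (1 / fact k) *\<^sub>R (f ^^ k) (mat 1)) sums
      ((mat 1 - P) + exp t *\<^sub>R ((1/2) *\<^sub>R (P + A)) + exp (- t) *\<^sub>R ((1/2) *\<^sub>R (P - A)))"
    using sums_add[OF sums_add[OF s1 s2[of t]] s2[of "- t"]] by (simp only:)
  then show ?thesis unfolding mat_exp_def f_def P_def by (simp add: sums_iff)
qed

definition horo :: "real ^ 'm::finite \<Rightarrow> real ^ 'm idx" where
  "horo x = (\<chi> k. case k of Co i \<Rightarrow> x $ i | Pen \<Rightarrow> 0 | Last \<Rightarrow> 0)"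

lemma horo_nth [simp]: "horo x $ Co i = x $ i" "horo x $ Pen = 0" "horo x $ Last = 0"
  by (simp_all add: horo_def)

definition null_axis :: "real ^ 'm::finite idx" where
  "null_axis = axis Last 1 - axis Pen 1"

definition horo_gen :: "real ^ 'm::finite \<Rightarrow> 'm sqmat" where
  "horo_gen x = (\<Sum>i\<in>UNIV. (x $ i) *\<^sub>R Nmat i)"

text \<open>The horospherical generators map the complement of \<open>Pen\<close> and \<open>Last\<close> into the line of \<open>null_axis\<close>,
  on which they vanish; this makes them nilpotent of order three.\<close>

lemma horo_gen_rows:
  "horo_gen x $ Co i = x $ i *\<^sub>R null_axis" "horo_gen x $ Pen = horo x" "horo_gen x $ Last = horo x"
proof -
  have *: "horo_gen x $ a $ b = (\<Sum>i\<in>UNIV. x $ i * Nmat i $ a $ b)" for a b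
    by (simp add: horo_gen_def sum_component)
  have N: "Nmat j $ a $ b = (if a = Co j then null_axis $ b else if (a = Pen \<or> a = Last) \<and> b = Co j then 1 else 0)"
    for j :: 'a and a b
    by (cases a; cases b) (auto simp: Nmat_def Emat_def elem_mat_def null_axis_def axis_def)
  show "horo_gen x $ Co i = x $ i *\<^sub>R null_axis"
    by (simp add: vec_eq_iff * N if_distrib[of "\<lambda>x. _ * x"] cong: if_cong)
  show "horo_gen x $ Pen = horo x" "horo_gen x $ Last = horo x"
    unfolding vec_eq_iff forall_idx * N by (simp_all add: if_distrib[of "\<lambda>x. _ * x"] cong: if_cong)
qed

lemma horo_gen_square_rows:
  "(horo_gen x ** horo_gen x) $ Co i = 0"
  "(horo_gen x ** horo_gen x) $ Pen = (x \<bullet> x) *\<^sub>R null_axis"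
  "(horo_gen x ** horo_gen x) $ Last = (x \<bullet> x) *\<^sub>R null_axis"
  by (simp_all add: row_mult sum_idx horo_gen_rows null_axis_def axis_def inner_vec_def
      scaleR_sum_left[symmetric] vec_eq_iff)

lemma horo_gen_cube: "horo_gen x ** (horo_gen x ** horo_gen x) = 0"
proof -
  have "(horo_gen x ** (horo_gen x ** horo_gen x)) $ a = 0" for a
    unfolding row_mult[of _ "horo_gen x ** horo_gen x"]
    by (cases a) (simp_all add: sum_idx horo_gen_rows horo_gen_square_rows null_axis_def axis_def)
  then show ?thesis by (simp add: vec_eq_iff)
qed

definition horo_mat :: "real ^ 'm::finite \<Rightarrow> 'm sqmat" where
  "horo_mat x = mat 1 + horo_gen x + (1 / 2) *\<^sub>R (horo_gen x ** horo_gen x)"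

lemma mat_1_row: "mat 1 $ a = axis a 1"
  by (auto simp: vec_eq_iff mat_def axis_def)

lemma horo_mat_rows:
  "horo_mat x $ Co i = axis (Co i) 1 + x $ i *\<^sub>R null_axis"
  "horo_mat x $ Pen = axis Pen 1 + horo x + (x \<bullet> x / 2) *\<^sub>R null_axis"
  "horo_mat x $ Last = axis Last 1 + horo x + (x \<bullet> x / 2) *\<^sub>R null_axis"
  by (simp_all add: horo_mat_def horo_gen_rows horo_gen_square_rows mat_1_row)

lemma Amat_rows: "Amat $ Co i = 0" "Amat $ Pen = axis Last 1" "Amat $ Last = axis Pen 1"
  by (auto simp: Amat_def Emat_def elem_mat_def vec_eq_iff axis_def)

lemma Amat_square_rows:
  "(Amat ** Amat) $ Co i = 0" "(Amat ** Amat) $ Pen = axis Pen 1" "(Amat ** Amat) $ Last = axis Last 1"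
  by (simp_all add: row_mult sum_idx Amat_rows axis_def)

lemma Amat_cube: "Amat ** (Amat ** Amat) = (Amat :: 'm::finite sqmat)"
proof -
  have "(Amat ** (Amat ** Amat)) $ a = (Amat :: 'm::finite sqmat) $ a" for a
    unfolding row_mult[of _ "Amat ** Amat"]
    by (cases a; simp add: sum_idx Amat_rows Amat_square_rows; simp add: axis_def)
  then show ?thesis by (simp add: vec_eq_iff)
qed

definition boost_mat :: "real \<Rightarrow> 'm::finite sqmat" where
  "boost_mat y = (mat 1 - Amat ** Amat) + (y / 2) *\<^sub>R (Amat ** Amat + Amat)
     + (1 / y / 2) *\<^sub>R (Amat ** Amat - Amat)"

lemma boost_mat_rows:
  "boost_mat y $ Co i = axis (Co i) 1"
  "boost_mat y $ Pen = ((y + 1 / y) / 2) *\<^sub>R axis Pen 1 + ((y - 1 / y) / 2) *\<^sub>R axis Last 1"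
  "boost_mat y $ Last = ((y - 1 / y) / 2) *\<^sub>R axis Pen 1 + ((y + 1 / y) / 2) *\<^sub>R axis Last 1"
  by (simp_all add: boost_mat_def Amat_rows Amat_square_rows mat_1_row vec_eq_iff field_simps)

lemma chart_map_eq:
  assumes "p \<in> chart_dom"
  shows "chart_map p = horo_mat (fst p) ** boost_mat (snd p)"
  using assms
  by (simp add: chart_map_def horo_gen_def[symmetric] mat_exp_nilpotent[OF horo_gen_cube]
      mat_exp_boost[OF Amat_cube] horo_mat_def boost_mat_def chart_dom_def exp_minus inverse_eq_divide)

lemma horo_mat_Lor: "horo_mat x \<in> Lor"
proof -
  have hh: "horo x \<bullet> horo x = x \<bullet> x" by (simp add: inner_idx) (simp add: inner_vec_def)
  have jh: "jflip (horo x) = - horo x" by (simp add: vec_eq_iff forall_idx sgnJ_def)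
  show ?thesis
    unfolding Lor_iff_rows forall_idx horo_mat_rows null_axis_def
    by (simp add: jflip_simps jh inner_simps inner_axis inner_axis' hh)
       (auto simp: axis_def sgnJ_def field_simps)
qed

lemma boost_mat_Lor:
  assumes "y \<noteq> 0"
  shows "boost_mat y \<in> Lor"
  unfolding Lor_iff_rows forall_idx boost_mat_rows
  by (simp add: jflip_simps inner_simps inner_axis inner_axis')
     (use assms in \<open>auto simp: axis_def sgnJ_def field_simps\<close>)

lemma chart_map_SO0:
  assumes "p \<in> chart_dom"
  shows "chart_map p \<in> SO0"
proof -
  define c :: "'a coords \<Rightarrow> 'a sqmat" where "c = (\<lambda>p. horo_mat (fst p) ** boost_mat (snd p))"
  have "c p \<in> SO0"
  proof (rule SO0_connected_image[where c = c and T = chart_dom and s = "(0, 1)" and t = p])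
    have "continuous_on chart_dom (\<lambda>p :: 'a coords. horo_gen (fst p))"
      unfolding horo_gen_def by (intro continuous_intros)
    then show "continuous_on chart_dom c"
      unfolding c_def horo_mat_def boost_mat_def
      by (intro continuous_on_matrix_mult continuous_intros) (auto simp: chart_dom_def)
    have dom: "chart_dom = (UNIV :: (real ^ 'a) set) \<times> {0<..}" by (auto simp: chart_dom_def)
    show "connected (chart_dom :: 'a coords set)"
      unfolding dom by (intro connected_Times connected_UNIV connected_Ioi)
    have "horo_mat (0 :: real ^ 'a) = mat 1" "boost_mat 1 = (mat 1 :: 'a sqmat)"
      by (simp_all add: horo_mat_def horo_gen_def boost_mat_def vec_eq_iff field_simps)
    then show "c (0, 1) \<in> SO0" by (simp add: c_def mat_1_SO0)
    show "(0, 1) \<in> (chart_dom :: 'a coords set)" by (simp add: chart_dom_def)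
    show "p \<in> chart_dom" by fact
    fix q :: "'a coords" assume "q \<in> chart_dom"
    then show "c q \<in> Lor"
      by (auto simp: c_def chart_dom_def intro!: Lor_mult horo_mat_Lor boost_mat_Lor)
  qed
  then show ?thesis by (simp add: chart_map_eq[OF assms] c_def)
qed

text \<open>If \<open>s\<close> and \<open>q\<close> are the entries \<open>Pen\<close> and \<open>Last\<close> of a point of the hyperboloid then \<open>y = q + s\<close> and
  \<open>rho = q - s\<close>, as \<open>q\<^sup>2 - s\<^sup>2 = 1 + x \<bullet> x\<close>. The functions \<open>rho1\<close>, \<open>rho2\<close> and \<open>rho3\<close> are its
  derivatives of order one, two and three, the last one at the points \<open>(0, y)\<close>.\<close>

definition rho :: "'m::finite coords \<Rightarrow> real" where
  "rho p = (1 + fst p \<bullet> fst p) / snd p"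

definition rho1 :: "'m::finite coords \<Rightarrow> 'm coords \<Rightarrow> real" where
  "rho1 p w = 2 * (fst p \<bullet> fst w) / snd p - (1 + fst p \<bullet> fst p) * snd w / (snd p)^2"

definition hyperboloid :: "'m::finite coords \<Rightarrow> real ^ 'm idx" where
  "hyperboloid p = (\<chi> k. case k of Co i \<Rightarrow> fst p $ i
     | Pen \<Rightarrow> (snd p - rho p) / 2 | Last \<Rightarrow> (snd p + rho p) / 2)"

lemma hyperboloid_nth [simp]: "hyperboloid p $ Co i = fst p $ i"
  "hyperboloid p $ Pen = (snd p - rho p) / 2"
  "hyperboloid p $ Last = (snd p + rho p) / 2"
  by (simp_all add: hyperboloid_def)

definition horo_coords :: "real ^ 'm::finite idx \<Rightarrow> 'm coords" where
  "horo_coords v = ((\<chi> i. v $ Co i), v $ Pen + v $ Last)"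

lemma horo_coords_linear: "linear horo_coords"
  by (rule linearI) (simp_all add: horo_coords_def vec_eq_iff algebra_simps)

lemma horo_coords_hyperboloid: "horo_coords (hyperboloid p) = p"
  by (simp add: horo_coords_def prod_eq_iff vec_eq_iff field_simps)

text \<open>The chart becomes the parametrisation of the hyperboloid by \<open>x\<close> and the light-cone coordinate \<open>y\<close>.\<close>

lemma chart_map_last_row:
  assumes "p \<in> chart_dom"
  shows "chart_map p $ Last = hyperboloid p"
  unfolding chart_map_eq[OF assms] row_mult sum_idx horo_mat_rows boost_mat_rows vec_eq_iff forall_idx null_axis_def
  using assms
  by (auto simp: rho_def axis_def chart_dom_def sum_component field_simps if_distrib[of "\<lambda>x. _ * x"] cong: if_cong)

lemma hyperboloid_horo_coords:
  assumes "A \<in> SO0"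
  shows "horo_coords (A $ Last) \<in> chart_dom" "hyperboloid (horo_coords (A $ Last)) = A $ Last"
proof -
  define v where "v = A $ Last"
  have pos: "v $ Last > 0" using SO0_last_pos[OF assms] by (simp add: v_def)
  have eq: "(v $ Last)^2 = 1 + (\<Sum>i\<in>UNIV. (v $ Co i)^2) + (v $ Pen)^2"
    using Lor_last_row[OF SO0_Lor[OF assms]] by (simp add: v_def)
  have "(\<Sum>i\<in>UNIV. (v $ Co i)^2) \<ge> 0" by (simp add: sum_nonneg)
  with eq have "(v $ Pen)^2 < (v $ Last)^2" by linarith
  then have "\<bar>v $ Pen\<bar> < v $ Last"
    using pos power2_less_imp_less[of "\<bar>v $ Pen\<bar>" "v $ Last"] by simp
  then have y: "v $ Pen + v $ Last > 0" by linarith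
  then show "horo_coords (A $ Last) \<in> chart_dom"
    by (simp add: chart_dom_def horo_coords_def v_def)
  have "1 + (\<Sum>i\<in>UNIV. v $ Co i * v $ Co i) = (v $ Last - v $ Pen) * (v $ Pen + v $ Last)"
    using eq by (simp add: power2_eq_square algebra_simps)
  then have r: "(1 + (\<Sum>i\<in>UNIV. v $ Co i * v $ Co i)) / (v $ Pen + v $ Last) = v $ Last - v $ Pen"
    using y by simp
  have "hyperboloid (horo_coords v) $ k = v $ k" for k
    by (cases k) (simp_all add: rho_def horo_coords_def inner_vec_def r)
  then show "hyperboloid (horo_coords (A $ Last)) = A $ Last" by (simp add: vec_eq_iff v_def)
qed

text \<open>A coset is determined by the last row of its elements. The chart parametrises the possible last
  rows, and it is inverted by a linear map.\<close>

lemma quot_proj_eq: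
  assumes "A \<in> SO0"
  shows "quot_proj A = horo_coords (A $ Last)"
proof -
  let ?p = "horo_coords (A $ Last)"
  have p: "?p \<in> chart_dom" and e: "hyperboloid ?p = A $ Last" using hyperboloid_horo_coords[OF assms] by auto
  have "inj_on (\<lambda>p. K_orbit (chart_map p)) (chart_dom :: 'a coords set)"
    by (rule inj_onI) (metis K_orbit_eq_iff chart_map_SO0 chart_map_last_row horo_coords_hyperboloid)
  moreover have "K_orbit A = K_orbit (chart_map ?p)"
    using K_orbit_eq_iff[OF assms chart_map_SO0[OF p]] chart_map_last_row[OF p] e by simp
  ultimately show ?thesis
    unfolding quot_proj_def using inv_into_f_f[OF _ p] by simp
qed

section \<open>The Lie algebra and its inner product\<close>

lemma elem_mat_nth [simp]: "elem_mat i j $ a $ b = (if a = i \<and> b = j then 1 else 0)"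
  by (simp add: elem_mat_def)

lemma Emat_nth: "Emat i j $ a $ b = sgnJ j * (if a = i \<and> b = j then 1 else 0) + (if a = j \<and> b = i then 1 else 0)"
  by (simp add: Emat_def sgnJ_def)

lemma inner_elem_mat: "elem_mat i j \<bullet> X = X $ i $ j"
proof -
  have "elem_mat i j \<bullet> X = (\<Sum>a\<in>UNIV. if a = i then X $ i $ j else 0)"
    unfolding inner_vec_def[of "elem_mat i j"]
  proof (rule sum.cong)
    fix a
    have "elem_mat i j $ a = (if a = i then axis j 1 else 0)"
      by (auto simp: vec_eq_iff axis_def)
    then show "elem_mat i j $ a \<bullet> X $ a = (if a = i then X $ i $ j else 0)"
      by (simp add: inner_axis')
  qed simp
  then show ?thesis by simp
qed

lemma inner_Emat: "Emat i j \<bullet> X = sgnJ j * X $ i $ j + X $ j $ i"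
  by (simp add: Emat_def sgnJ_def inner_add_left inner_elem_mat inner_diff_left)

lemma inner_Ebasis:
  assumes "i < j" "k < l"
  shows "Emat i j \<bullet> Emat k l = (if i = k \<and> j = l then 2 else 0)"
proof -
  have "i \<noteq> j" "k \<noteq> l" "\<not> (i = l \<and> j = k)" using assms by auto
  then show ?thesis by (simp add: inner_Emat Emat_nth) (auto simp: sgnJ_def)
qed

lemma Ebasis_inner:
  assumes "b \<in> Ebasis" "b' \<in> Ebasis"
  shows "b \<bullet> b' = (if b = b' then 2 else 0)"
proof -
  obtain i j k l where b: "b = Emat i j" "i < j" and b': "b' = Emat k l" "k < l"
    using assms unfolding Ebasis_def by blast
  then show ?thesis using inner_Ebasis[OF b(2) b'(2)] inner_Ebasis[OF b(2) b(2)] by auto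
qed

lemma finite_Ebasis: "finite (Ebasis :: 'm::{finite,linorder} sqmat set)"
proof -
  have "Ebasis \<subseteq> (\<lambda>(i, j). Emat i j :: 'm sqmat) ` UNIV" by (auto simp: Ebasis_def)
  then show ?thesis by (meson finite finite_imageI finite_subset)
qed

lemma independent_Ebasis: "independent (Ebasis :: 'm::{finite,linorder} sqmat set)"
proof (rule pairwise_orthogonal_independent)
  show "pairwise orthogonal (Ebasis :: 'm sqmat set)"
    by (simp add: pairwise_def orthogonal_def Ebasis_inner)
  show "(0 :: 'm sqmat) \<notin> Ebasis" using Ebasis_inner by fastforce
qed

text \<open>The basis is orthogonal for the Euclidean inner product of matrices, and each of its elements has
  squared length \<open>2\<close>.\<close>

lemma lie_inner_eq:
  fixes X Y :: "'m::{finite,linorder} sqmat"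
  assumes "X \<in> span Ebasis" "Y \<in> span Ebasis"
  shows "lie_inner X Y = (X \<bullet> Y) / 2"
proof -
  have rep: "Z = (\<Sum>b\<in>Ebasis. representation Ebasis Z b *\<^sub>R b)" if "Z \<in> span Ebasis" for Z :: "'m sqmat"
    by (rule real_vector.sum_representation_eq[OF independent_Ebasis that finite_Ebasis subset_refl, symmetric])
  have "X \<bullet> Y = (\<Sum>b\<in>Ebasis. \<Sum>c\<in>Ebasis. representation Ebasis X b * (representation Ebasis Y c * (b \<bullet> c)))"
  proof -
    have "X \<bullet> Y = (\<Sum>b\<in>Ebasis. representation Ebasis X b *\<^sub>R b) \<bullet> (\<Sum>c\<in>Ebasis. representation Ebasis Y c *\<^sub>R c)"
      using rep[OF assms(1)] rep[OF assms(2)] by (rule arg_cong2)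
    then show ?thesis
      unfolding inner_sum_left inner_scaleR_left
      by (simp only: inner_sum_right inner_scaleR_right sum_distrib_left)
  qed
  also have "\<dots> = (\<Sum>b\<in>Ebasis. \<Sum>c\<in>Ebasis. if c = b then 2 * (representation Ebasis X b * representation Ebasis Y b) else 0)"
    by (intro sum.cong refl) (auto simp: Ebasis_inner)
  also have "\<dots> = 2 * lie_inner X Y"
    by (simp add: finite_Ebasis lie_inner_def sum_distrib_left)
  finally show ?thesis by simp
qed

text \<open>The entries of \<open>X\<close> at \<open>(a, b)\<close> and \<open>(b, a)\<close> determine each other by the sign that is built into
  \<open>Emat\<close>. Adding \<open>X\<close> to itself with the two indices exchanged collects them into multiples of basis
  elements, whence the factor \<open>1 / 2\<close>.\<close>

lemma span_Ebasis_iff: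
  fixes X :: "'m::{finite,linorder} sqmat"
  shows "X \<in> span Ebasis \<longleftrightarrow> (\<forall>a b. sgnJ b * X $ a $ b = - (sgnJ a * X $ b $ a))"
proof
  assume X: "X \<in> span Ebasis"
  have "sgnJ b * X $ a $ b + sgnJ a * X $ b $ a = 0" for a b
  proof (rule linear_eq_0_on_span[OF _ _ X])
    show "linear (\<lambda>X :: 'm sqmat. sgnJ b * X $ a $ b + sgnJ a * X $ b $ a)"
      by (rule linearI) (simp_all add: algebra_simps)
    fix E :: "'m sqmat" assume "E \<in> Ebasis"
    then obtain i j where E: "E = Emat i j" and ij: "i < j" unfolding Ebasis_def by blast
    have "i \<noteq> Last" using ij by (cases i; cases j) (auto simp: less_idx_def)
    then have "sgnJ i = -1" by (simp add: sgnJ_def)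
    moreover have "i \<noteq> j" using ij by simp
    ultimately show "sgnJ b * E $ a $ b + sgnJ a * E $ b $ a = 0"
      by (cases "a = i"; cases "b = j"; cases "a = j"; cases "b = i") (simp_all add: E Emat_nth)
  qed
  then show "\<forall>a b. sgnJ b * X $ a $ b = - (sgnJ a * X $ b $ a)"
    unfolding eq_neg_iff_add_eq_0 by blast
next
  assume skew: "\<forall>a b. sgnJ b * X $ a $ b = - (sgnJ a * X $ b $ a)"
  have lt: "X $ a $ b *\<^sub>R elem_mat a b + X $ b $ a *\<^sub>R elem_mat b a \<in> span Ebasis" if "a < b" for a b
  proof -
    have "a \<noteq> Last" using that by (cases a; cases b) (auto simp: less_idx_def)
    then have "sgnJ b * X $ a $ b = X $ b $ a"
      using spec[OF spec[OF skew, of a], of b] by (simp add: sgnJ_def)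
    then have X: "X $ a $ b = sgnJ b * X $ b $ a"
      by (metis mult.assoc mult_1 sgnJ_square)
    have "X $ a $ b *\<^sub>R elem_mat a b + X $ b $ a *\<^sub>R elem_mat b a = X $ b $ a *\<^sub>R Emat a b"
      unfolding X by (simp add: Emat_def sgnJ_def algebra_simps)
    moreover have "Emat a b \<in> Ebasis" using that unfolding Ebasis_def by blast
    ultimately show ?thesis by (simp add: span_base span_scale)
  qed
  have "X $ a $ b *\<^sub>R elem_mat a b + X $ b $ a *\<^sub>R elem_mat b a \<in> span Ebasis" for a b
  proof (cases a b rule: linorder_cases)
    case equal
    have "sgnJ a * X $ a $ a + sgnJ a * X $ a $ a = 0"
      using spec[OF spec[OF skew, of a], of a] by linarith
    then have "X $ a $ b = 0" using equal by (auto simp: sgnJ_def split: if_splits)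
    then show ?thesis using equal by (simp add: span_zero)
  next
    case greater
    then show ?thesis using lt[OF greater] by (simp add: add.commute)
  qed (rule lt)
  then have *: "(\<Sum>a\<in>UNIV. \<Sum>b\<in>UNIV. X $ a $ b *\<^sub>R elem_mat a b + X $ b $ a *\<^sub>R elem_mat b a) \<in> span Ebasis"
    by (intro span_sum)
  have "(\<Sum>a\<in>UNIV. \<Sum>b\<in>UNIV. X $ a $ b *\<^sub>R elem_mat a b) $ i $ j = X $ i $ j" for i j
  proof -
    have "(X $ a $ b *\<^sub>R elem_mat a b) $ i $ j = (if b = j then if a = i then X $ i $ j else 0 else 0)" for a b
      by simp
    then have "(\<Sum>a\<in>UNIV. \<Sum>b\<in>UNIV. X $ a $ b *\<^sub>R elem_mat a b) $ i $ j
        = (\<Sum>a\<in>UNIV. \<Sum>b\<in>UNIV. if b = j then if a = i then X $ i $ j else 0 else 0)"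
      by (simp only: sum_component)
    then show ?thesis by simp
  qed
  then have X: "(\<Sum>a\<in>UNIV. \<Sum>b\<in>UNIV. X $ a $ b *\<^sub>R elem_mat a b) = X"
    by (simp add: vec_eq_iff)
  have "(\<Sum>a\<in>UNIV. \<Sum>b\<in>UNIV. X $ b $ a *\<^sub>R elem_mat b a) = X"
    by (subst sum.swap) (rule X)
  then have "X + X \<in> span Ebasis" using * by (simp add: sum.distrib X)
  then have "(1 / 2) *\<^sub>R (X + X) \<in> span Ebasis" by (rule span_scale)
  then show "X \<in> span Ebasis" by (simp flip: scaleR_2)
qed

lemma left_inv_metric_translate:
  fixes A :: "'m::{finite,linorder} sqmat"
  assumes "A \<in> SO0" "X \<in> span Ebasis" "Y \<in> span Ebasis"
  shows "left_inv_metric A (A ** X) (A ** Y) = (X \<bullet> Y) / 2"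
proof -
  have "matrix_inv A ** A = mat 1"
    using someI_ex[OF Lor_inverse(3)[OF SO0_Lor[OF assms(1)], unfolded invertible_def]]
    unfolding matrix_inv_def by blast
  then have "matrix_inv A ** (A ** Z) = Z" for Z :: "'m sqmat" by (simp add: matrix_mul_assoc)
  then show ?thesis unfolding left_inv_metric_def using lie_inner_eq[OF assms(2,3)] by simp
qed

section \<open>The differential of the projection\<close>

definition plane_cos :: "'m idx \<Rightarrow> real \<Rightarrow> real" where
  "plane_cos j t = (if j = Last then cosh t else cos t)"

definition plane_sin :: "'m idx \<Rightarrow> real \<Rightarrow> real" where
  "plane_sin j t = (if j = Last then sinh t else sin t)"

text \<open>The one-parameter group generated by \<open>Emat i j\<close>: rotations in the plane of \<open>i\<close> and \<open>j\<close>, or boosts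
  if \<open>j\<close> is the time-like index.\<close>

definition plane_curve :: "'m::finite idx \<Rightarrow> 'm idx \<Rightarrow> real \<Rightarrow> 'm sqmat" where
  "plane_curve i j t = mat 1 + (plane_cos j t - 1) *\<^sub>R (elem_mat i i + elem_mat j j) + plane_sin j t *\<^sub>R Emat i j"

lemma plane_cos_sin: "(plane_cos j t)^2 - sgnJ j * (plane_sin j t)^2 = 1"
  by (simp add: plane_cos_def plane_sin_def sgnJ_def cosh_square_eq)

lemma plane_curve_rows:
  assumes "i \<noteq> j"
  shows "plane_curve i j t $ a =
    (if a = i then plane_cos j t *\<^sub>R axis i 1 + (sgnJ j * plane_sin j t) *\<^sub>R axis j 1
     else if a = j then plane_cos j t *\<^sub>R axis j 1 + plane_sin j t *\<^sub>R axis i 1 else axis a 1)"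
  using assms by (auto simp: plane_curve_def vec_eq_iff Emat_nth mat_def axis_def)

lemma axis_component: "axis i x $ j = (if j = i then x else 0)"
  by (simp add: axis_def)

lemma plane_curve_Lor:
  fixes i j :: "'m::{finite,linorder} idx"
  assumes "i < j"
  shows "plane_curve i j t \<in> Lor"
proof -
  have ij: "i \<noteq> j" "i \<noteq> Last" using assms by (auto, cases j) (auto simp: less_idx_def)
  have e: "sgnJ i = -1" using ij by (simp add: sgnJ_def)
  have cs: "plane_cos j t * plane_cos j t = 1 + sgnJ j * (plane_sin j t * plane_sin j t)"
    using plane_cos_sin[of j t] by (simp add: power2_eq_square)
  show ?thesis
    unfolding Lor_iff_rows plane_curve_rows[OF ij(1)]
    using ij by (auto simp: jflip_simps inner_simps inner_axis inner_axis' axis_component e cs algebra_simps)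
qed

lemma plane_curve_derivative:
  "((\<lambda>t. A ** plane_curve i j t) has_derivative (\<lambda>t. t *\<^sub>R (A ** Emat i j))) (at 0)"
proof -
  have "(plane_cos j has_real_derivative 0) (at 0)"
    unfolding plane_cos_def[abs_def] by (cases "j = Last") (auto intro!: derivative_eq_intros)
  then have c: "(plane_cos j has_derivative (\<lambda>t. 0)) (at 0)"
    by (simp add: has_field_derivative_def lambda_zero)
  have "(plane_sin j has_real_derivative 1) (at 0)"
    unfolding plane_sin_def[abs_def] by (cases "j = Last") (auto intro!: derivative_eq_intros)
  then have s: "(plane_sin j has_derivative (\<lambda>t. t)) (at 0)"
    by (simp add: has_field_derivative_def lambda_one)
  have "((\<lambda>t. A + (plane_cos j t - 1) *\<^sub>R (A ** (elem_mat i i + elem_mat j j)) + plane_sin j t *\<^sub>R (A ** Emat i j))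
      has_derivative (\<lambda>t. 0 + (0 - 0) *\<^sub>R (A ** (elem_mat i i + elem_mat j j)) + t *\<^sub>R (A ** Emat i j))) (at 0)"
    by (intro has_derivative_add has_derivative_scaleR_left has_derivative_diff has_derivative_const c s)
  then show ?thesis by (simp add: plane_curve_def matrix_mult_simps)
qed

text \<open>A derivative within the group is determined on the velocities of curves in the group. The curves
  \<open>A ** plane_curve i j t\<close> provide a basis of the tangent space at \<open>A\<close>, and along them the
  projection is linear in the last row.\<close>

lemma quot_proj_derivative:
  fixes A :: "'m::{finite,linorder} sqmat"
  assumes A: "A \<in> SO0" and D: "(quot_proj has_derivative D) (at A within SO0)" and X: "X \<in> span Ebasis"
  shows "D (A ** X) = horo_coords ((A ** X) $ Last)"
proof -
  have hl: "linear (\<lambda>M :: 'm sqmat. horo_coords (M $ Last))"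
    by (rule linearI) (simp_all add: linear_add[OF horo_coords_linear] linear_cmul[OF horo_coords_linear])
  have basis: "D (A ** Emat i j) = horo_coords ((A ** Emat i j) $ Last)" if ij: "i < j" for i j
  proof -
    define c where "c t = A ** plane_curve i j t" for t
    have c0: "c 0 = A"
      by (simp add: c_def plane_curve_def plane_cos_def plane_sin_def)
    have cont: "continuous_on UNIV c"
      unfolding c_def plane_curve_def plane_cos_def plane_sin_def
      by (cases "j = Last") (auto intro!: continuous_on_matrix_mult continuous_intros)
    have cL: "c t \<in> Lor" for t
      unfolding c_def by (rule Lor_mult[OF SO0_Lor[OF A] plane_curve_Lor[OF ij]])
    have cS: "c t \<in> SO0" for t
      by (rule SO0_connected_image[OF cont connected_UNIV cL UNIV_I _ UNIV_I, of 0]) (simp add: c0 A)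
    have dc: "(c has_derivative (\<lambda>t. t *\<^sub>R (A ** Emat i j))) (at 0)"
      unfolding c_def by (rule plane_curve_derivative)
    have "(quot_proj has_derivative D) (at (c 0) within range c)"
      unfolding c0 by (rule has_derivative_subset[OF D]) (use cS in auto)
    then have 1: "((\<lambda>t. quot_proj (c t)) has_derivative (\<lambda>t. D (t *\<^sub>R (A ** Emat i j)))) (at 0)"
      using has_derivative_in_compose[of c _ 0 UNIV quot_proj D] dc by simp
    have "((\<lambda>t. horo_coords (c t $ Last)) has_derivative (\<lambda>t. horo_coords ((t *\<^sub>R (A ** Emat i j)) $ Last))) (at 0)"
      using bounded_linear.has_derivative[OF linear_conv_bounded_linear[THEN iffD1, OF hl] dc] .
    then have 2: "((\<lambda>t. quot_proj (c t)) has_derivative (\<lambda>t. horo_coords ((t *\<^sub>R (A ** Emat i j)) $ Last))) (at 0)"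
      by (simp add: quot_proj_eq[OF cS])
    from fun_cong[OF has_derivative_unique[OF 1 2], of 1] show ?thesis by simp
  qed
  have lD: "linear D" using D has_derivative_bounded_linear bounded_linear.linear by blast
  have l1: "linear (\<lambda>X :: 'm sqmat. D (A ** X))"
    by (rule linearI) (simp_all add: matrix_mult_simps linear_add[OF lD] linear_cmul[OF lD])
  have l2: "linear (\<lambda>X :: 'm sqmat. horo_coords ((A ** X) $ Last))"
    by (rule linearI)
       (simp_all add: matrix_mult_simps linear_add[OF horo_coords_linear] linear_cmul[OF horo_coords_linear])
  show ?thesis
    by (rule linear_eq_on_span[OF l1 l2 _ X]) (use basis in \<open>auto simp: Ebasis_def\<close>)
qed

section \<open>Horizontal lifts and the quotient metric\<close>

definition row_act :: "real ^ 'm::finite idx \<Rightarrow> 'm sqmat \<Rightarrow> real ^ 'm idx" where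
  "row_act v X = (\<Sum>k\<in>UNIV. v $ k *\<^sub>R X $ k)"

lemma row_mult_act: "(A ** X) $ a = row_act (A $ a) X"
  by (simp add: row_mult row_act_def)

text \<open>Skewness for the Lorentz form moves a vector from the right of \<open>X\<close> to its left.\<close>

lemma span_Ebasis_skew:
  assumes "X \<in> span Ebasis"
  shows "jflip u \<bullet> X $ a = - (sgnJ a * row_act u X $ a)"
proof -
  have "sgnJ b * u $ b * X $ a $ b = - (sgnJ a * (u $ b * X $ b $ a))" for b
    using assms unfolding span_Ebasis_iff by (simp add: mult_ac) (metis mult.left_commute mult_minus_right)
  then show ?thesis
    by (simp add: inner_vec_def row_act_def sum_component sum_distrib_left sum_negf)
qed

text \<open>For \<open>h\<close> tangent to the hyperboloid at \<open>v\<close>, the matrix of the Lie algebra of least length that moves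
  \<open>v\<close> by \<open>h\<close>: up to the factor \<open>Jmat\<close> on the right, the skew matrix \<open>v w\<^sup>T - w v\<^sup>T\<close> with
  \<open>w = jflip h\<close>, normalised by \<open>v \<bullet> v\<close>.\<close>

definition hor_lift :: "real ^ 'm::finite idx \<Rightarrow> real ^ 'm idx \<Rightarrow> 'm sqmat" where
  "hor_lift v h = (\<chi> a. (1 / (v \<bullet> v)) *\<^sub>R (v $ a *\<^sub>R h - (jflip h $ a) *\<^sub>R jflip v))"

lemma hor_lift_span: "hor_lift v h \<in> span Ebasis"
  unfolding span_Ebasis_iff
  by (auto simp: hor_lift_def sgnJ_def field_simps)

lemma row_act_hor_lift:
  assumes "v \<noteq> 0" "v \<bullet> jflip h = 0"
  shows "row_act v (hor_lift v h) = h"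
proof -
  have "row_act v (hor_lift v h) = (1 / (v \<bullet> v)) *\<^sub>R ((\<Sum>a\<in>UNIV. v $ a * v $ a) *\<^sub>R h - (\<Sum>a\<in>UNIV. v $ a * jflip h $ a) *\<^sub>R jflip v)"
    unfolding scaleR_sum_left sum_subtractf[symmetric] scaleR_sum_right row_act_def
    by (rule sum.cong) (simp_all add: hor_lift_def scaleR_diff_right mult.left_commute)
  also have "\<dots> = (1 / (v \<bullet> v)) *\<^sub>R ((v \<bullet> v) *\<^sub>R h - (v \<bullet> jflip h) *\<^sub>R jflip v)"
    by (simp only: inner_vec_def inner_real_def)
  also have "\<dots> = h" using assms by simp
  finally show ?thesis .
qed

text \<open>The lift is orthogonal to every \<open>Y\<close> that does not move \<open>v\<close>, i.e. it is horizontal, and applied to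
  a second lift the formula gives the metric.\<close>

lemma inner_hor_lift:
  assumes "Y \<in> span Ebasis"
  shows "hor_lift v h \<bullet> Y = 2 * (h \<bullet> row_act v Y) / (v \<bullet> v)"
proof -
  have "hor_lift v h $ a \<bullet> Y $ a = (1 / (v \<bullet> v)) * (v $ a * (h \<bullet> Y $ a) + h $ a * row_act v Y $ a)" for a
  proof -
    have s: "sgnJ a * (sgnJ a * x) = x" for x :: real by (simp add: sgnJ_def)
    show ?thesis
      by (simp add: hor_lift_def inner_diff_left span_Ebasis_skew[OF assms] s mult_ac)
  qed
  then have "hor_lift v h \<bullet> Y = (1 / (v \<bullet> v)) * ((\<Sum>a\<in>UNIV. v $ a * (h \<bullet> Y $ a)) + (\<Sum>a\<in>UNIV. h $ a * row_act v Y $ a))"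
    unfolding inner_vec_def[of "hor_lift v h"] by (simp add: sum_distrib_left sum.distrib algebra_simps)
  also have "(\<Sum>a\<in>UNIV. v $ a * (h \<bullet> Y $ a)) = h \<bullet> row_act v Y"
    by (simp add: row_act_def inner_sum_right)
  also have "(\<Sum>a\<in>UNIV. h $ a * row_act v Y $ a) = h \<bullet> row_act v Y"
    by (simp add: inner_vec_def[of h "row_act v Y"])
  finally show ?thesis by simp
qed

definition hyperboloid_deriv :: "'m::finite coords \<Rightarrow> 'm coords \<Rightarrow> real ^ 'm idx" where
  "hyperboloid_deriv p z = (\<chi> k. case k of Co i \<Rightarrow> fst z $ i
     | Pen \<Rightarrow> (snd z - rho1 p z) / 2 | Last \<Rightarrow> (snd z + rho1 p z) / 2)"

lemma hyperboloid_deriv_nth [simp]: "hyperboloid_deriv p z $ Co i = fst z $ i"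
  "hyperboloid_deriv p z $ Pen = (snd z - rho1 p z) / 2" "hyperboloid_deriv p z $ Last = (snd z + rho1 p z) / 2"
  by (simp_all add: hyperboloid_deriv_def)

lemma horo_coords_hyperboloid_deriv: "horo_coords (hyperboloid_deriv p z) = z"
  by (simp add: horo_coords_def prod_eq_iff vec_eq_iff field_simps)

lemma inner_hyperboloid: "hyperboloid p \<bullet> hyperboloid p = fst p \<bullet> fst p + ((snd p)^2 + (rho p)^2) / 2"
  by (simp add: inner_idx inner_vec_def power2_eq_square field_simps)

lemma inner_hyperboloid_deriv:
  "hyperboloid_deriv p w \<bullet> hyperboloid_deriv p z = fst w \<bullet> fst z + (snd w * snd z + rho1 p w * rho1 p z) / 2"
  by (simp add: inner_idx inner_vec_def[of "fst w"] field_simps)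

lemma hyperboloid_deriv_tangent:
  assumes "p \<in> chart_dom"
  shows "hyperboloid p \<bullet> jflip (hyperboloid_deriv p z) = 0"
proof -
  have "(\<Sum>i\<in>UNIV. fst p $ i * fst z $ i) = fst p \<bullet> fst z" by (simp add: inner_vec_def)
  then show ?thesis
    using assms
    by (simp add: inner_idx sgnJ_def sum_negf chart_dom_def rho_def rho1_def field_simps power2_eq_square)
qed

text \<open>The kernel of \<open>horo_coords\<close> is spanned by the light-like vector \<open>null_axis\<close>, whose Lorentz product
  with a point of the hyperboloid is \<open>y > 0\<close>; so it contains no nonzero tangent vector.\<close>

lemma hyperboloid_tangent_eq_0:
  assumes "p \<in> chart_dom" "hyperboloid p \<bullet> jflip u = 0" "horo_coords u = 0"
  shows "u = 0"
proof -
  have u: "u $ Co i = 0" "u $ Pen = - u $ Last" for i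
    using assms(3) by (auto simp: horo_coords_def prod_eq_iff vec_eq_iff)
  have "snd p * u $ Last = 0"
    using assms(2) by (simp add: inner_idx sgnJ_def u field_simps)
  then have "u $ Last = 0" using assms(1) by (simp add: chart_dom_def)
  then show ?thesis using u by (simp add: vec_eq_iff forall_idx)
qed

text \<open>The differential of the projection at \<open>A\<close> sends \<open>A ** X\<close> to \<open>horo_coords (row_act v X)\<close> with \<open>v\<close> the
  last row of \<open>A\<close>; its kernel consists of the \<open>A ** X\<close> with \<open>row_act v X = 0\<close>. The lifts of the vectors
  \<open>hyperboloid_deriv p z\<close> are orthogonal to this kernel and are mapped to \<open>z\<close>, so their inner
  products are the values of the metric.\<close>

lemma quotient_metric_formula:
  fixes g :: "'m::{finite,linorder} coords \<Rightarrow> 'm coords \<Rightarrow> 'm coords \<Rightarrow> real"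
  assumes g: "quot_riemannian_submersion g" and p: "p \<in> chart_dom"
  shows "g p z w = (hyperboloid_deriv p z \<bullet> hyperboloid_deriv p w) / (hyperboloid p \<bullet> hyperboloid p)"
proof -
  define A where "A = chart_map p"
  define v where "v = hyperboloid p"
  have A: "A \<in> SO0" unfolding A_def by (rule chart_map_SO0[OF p])
  have Av: "A $ Last = v" unfolding A_def v_def by (rule chart_map_last_row[OF p])
  have qA: "quot_proj A = p" unfolding quot_proj_eq[OF A] Av v_def by (rule horo_coords_hyperboloid)
  obtain D where D: "(quot_proj has_derivative D) (at A within SO0)"
    and iso: "\<And>U V. \<lbrakk>U \<in> tangent_SO0 A; \<forall>W\<in>tangent_SO0 A. D W = 0 \<longrightarrow> left_inv_metric A U W = 0;
      V \<in> tangent_SO0 A; \<forall>W\<in>tangent_SO0 A. D W = 0 \<longrightarrow> left_inv_metric A V W = 0\<rbrakk>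
      \<Longrightarrow> g (quot_proj A) (D U) (D V) = left_inv_metric A U V"
    using bspec[OF g[unfolded quot_riemannian_submersion_def] A] unfolding Let_def by blast
  have DX: "D (A ** X) = horo_coords (row_act v X)" if "X \<in> span Ebasis" for X
    using quot_proj_derivative[OF A D that] by (simp add: row_mult_act Av)
  have v0: "v \<noteq> 0"
  proof
    assume "v = 0"
    then have "p = horo_coords 0" using horo_coords_hyperboloid[of p] by (simp add: v_def)
    then have "p = 0" by (simp only: linear_0[OF horo_coords_linear])
    then show False using p by (simp add: chart_dom_def)
  qed
  define X where "X z = hor_lift v (hyperboloid_deriv p z)" for z
  have X: "X z \<in> span Ebasis" for z unfolding X_def by (rule hor_lift_span)
  have vX: "row_act v (X z) = hyperboloid_deriv p z" for z
    unfolding X_def using row_act_hor_lift[OF v0] hyperboloid_deriv_tangent[OF p] by (simp add: v_def)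
  have tan: "A ** X z \<in> tangent_SO0 A" for z unfolding tangent_SO0_def using X by blast
  have hor: "\<forall>W\<in>tangent_SO0 A. D W = 0 \<longrightarrow> left_inv_metric A (A ** X z) W = 0" for z
  proof (intro ballI impI)
    fix W assume "W \<in> tangent_SO0 A" "D W = 0"
    then obtain Y where Y: "Y \<in> span Ebasis" "W = A ** Y" unfolding tangent_SO0_def by blast
    have "jflip v \<bullet> row_act v Y = (\<Sum>a\<in>UNIV. v $ a * (jflip v \<bullet> Y $ a))"
      by (simp add: row_act_def inner_sum_right)
    also have "\<dots> = - (\<Sum>a\<in>UNIV. jflip v $ a * row_act v Y $ a)"
      by (simp add: span_Ebasis_skew[OF Y(1)] sum_negf mult_ac)
    also have "\<dots> = - (jflip v \<bullet> row_act v Y)"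
      by (simp add: inner_vec_def[of "jflip v"])
    finally have "hyperboloid p \<bullet> jflip (row_act v Y) = 0" by (simp add: inner_jflip_left v_def)
    moreover have "horo_coords (row_act v Y) = 0" using \<open>D W = 0\<close> DX[OF Y(1)] Y(2) by simp
    ultimately have "row_act v Y = 0" by (rule hyperboloid_tangent_eq_0[OF p])
    then show "left_inv_metric A (A ** X z) W = 0"
      unfolding Y(2) left_inv_metric_translate[OF A X Y(1)] unfolding X_def
      by (simp add: inner_hor_lift[OF Y(1)])
  qed
  have "g (quot_proj A) (D (A ** X z)) (D (A ** X w)) = (X z \<bullet> X w) / 2"
    using iso[OF tan hor tan hor] left_inv_metric_translate[OF A X X] by simp
  moreover have "D (A ** X z) = z" for z
    using DX[OF X] vX by (simp add: horo_coords_hyperboloid_deriv)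
  moreover have "X z \<bullet> X w = 2 * (hyperboloid_deriv p z \<bullet> hyperboloid_deriv p w) / (v \<bullet> v)"
    using inner_hor_lift[OF X] vX unfolding X_def by simp
  ultimately show ?thesis using qA by (simp add: v_def)
qed

section \<open>The metric of the hyperboloid in coordinates\<close>

definition rho2 :: "'m::finite coords \<Rightarrow> 'm coords \<Rightarrow> 'm coords \<Rightarrow> real" where
  "rho2 p v w = 2 * (fst v \<bullet> fst w) / snd p - 2 * (fst p \<bullet> fst w) * snd v / (snd p)^2
     - 2 * (fst p \<bullet> fst v) * snd w / (snd p)^2 + 2 * (1 + fst p \<bullet> fst p) * snd v * snd w / (snd p)^3"

definition rho3 :: "real \<Rightarrow> 'm::finite coords \<Rightarrow> 'm coords \<Rightarrow> 'm coords \<Rightarrow> real" where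
  "rho3 y u v w = - 2 * ((fst v \<bullet> fst w) * snd u + (fst u \<bullet> fst w) * snd v + (fst u \<bullet> fst v) * snd w) / y^2
     - 6 * snd u * snd v * snd w / y^4"

lemma rho_derivative:
  assumes "p \<in> chart_dom"
  shows "(rho has_derivative rho1 p) (at p)"
proof -
  have "((\<lambda>p. (1 + fst p \<bullet> fst p) / snd p) has_derivative rho1 p) (at p)"
    by (rule derivative_eq_intros refl | use assms in \<open>force simp: chart_dom_def\<close>)+
       (use assms in \<open>auto simp: chart_dom_def rho1_def fun_eq_iff field_simps power2_eq_square inner_commute\<close>)
  then show ?thesis by (simp add: rho_def[abs_def])
qed

lemma rho1_derivative:
  assumes "p \<in> chart_dom"
  shows "((\<lambda>p. rho1 p w) has_derivative (\<lambda>v. rho2 p v w)) (at p)"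
  unfolding rho1_def
  by (rule derivative_eq_intros refl | use assms in \<open>force simp: chart_dom_def\<close>)+
     (use assms in \<open>auto simp: chart_dom_def rho2_def fun_eq_iff field_simps power2_eq_square power3_eq_cube inner_commute\<close>)

lemma rho2_derivative:
  assumes "0 < y"
  shows "((\<lambda>p. rho2 p v w) has_derivative (\<lambda>u. rho3 y u v w)) (at (0, y))"
  unfolding rho2_def
  by (rule derivative_eq_intros refl | use assms in force)+
     (use assms in \<open>auto simp: rho3_def fun_eq_iff field_simps power2_eq_square power3_eq_cube power4_eq_xxxx inner_commute\<close>)

text \<open>Numerator and denominator of the metric in coordinates. In the names of functions, the digits \<open>1\<close>
  and \<open>2\<close> stand for derivatives of first order, at an arbitrary point, and of second order, at
  \<open>(0, y)\<close>.\<close>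

definition metric_den :: "'m::finite coords \<Rightarrow> real" where
  "metric_den p = fst p \<bullet> fst p + ((snd p)^2 + (rho p)^2) / 2"

definition metric_den1 :: "'m::finite coords \<Rightarrow> 'm coords \<Rightarrow> real" where
  "metric_den1 p v = 2 * (fst p \<bullet> fst v) + snd p * snd v + rho p * rho1 p v"

definition metric_num :: "'m::finite coords \<Rightarrow> 'm coords \<Rightarrow> 'm coords \<Rightarrow> real" where
  "metric_num p w z = fst w \<bullet> fst z + (snd w * snd z + rho1 p w * rho1 p z) / 2"

definition metric_num1 :: "'m::finite coords \<Rightarrow> 'm coords \<Rightarrow> 'm coords \<Rightarrow> 'm coords \<Rightarrow> real" where
  "metric_num1 p v w z = (rho2 p v w * rho1 p z + rho1 p w * rho2 p v z) / 2"

definition metric_num2 :: "real \<Rightarrow> 'm::finite coords \<Rightarrow> 'm coords \<Rightarrow> 'm coords \<Rightarrow> 'm coords \<Rightarrow> real" where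
  "metric_num2 y u v w z = (rho3 y u v w * rho1 ((0,y) :: 'm coords) z + rho2 ((0,y) :: 'm coords) v w * rho2 ((0,y) :: 'm coords) u z
     + rho2 ((0,y) :: 'm coords) u w * rho2 ((0,y) :: 'm coords) v z + rho1 ((0,y) :: 'm coords) w * rho3 y u v z) / 2"

definition metric_den2 :: "real \<Rightarrow> 'm::finite coords \<Rightarrow> 'm coords \<Rightarrow> real" where
  "metric_den2 y u v = 2 * (fst u \<bullet> fst v) + snd u * snd v + rho1 ((0,y) :: 'm coords) u * rho1 ((0,y) :: 'm coords) v
     + rho ((0,y) :: 'm coords) * rho2 ((0,y) :: 'm coords) u v"

lemma metric_den_pos: "p \<in> chart_dom \<Longrightarrow> 0 < metric_den p"
  unfolding metric_den_def chart_dom_def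
  by (smt (verit) add_divide_distrib half_gt_zero_iff inner_ge_zero mem_Collect_eq zero_le_power2 zero_less_power)

lemma metric_den_derivative:
  assumes p: "p \<in> chart_dom"
  shows "(metric_den has_derivative metric_den1 p) (at p)"
proof -
  have "((\<lambda>p. fst p \<bullet> fst p + ((snd p)^2 + (rho p)^2) / 2) has_derivative (\<lambda>v. metric_den1 p v)) (at p)"
    by (rule rho_derivative[OF p] derivative_eq_intros zero_neq_numeral[symmetric] | rule refl)+
       (auto simp: metric_den1_def fun_eq_iff field_simps inner_commute)
  then show ?thesis by (simp add: metric_den_def[abs_def])
qed

lemma metric_den1_derivative:
  assumes y: "0 < y"
  shows "((\<lambda>p. metric_den1 p v) has_derivative (\<lambda>u. metric_den2 y u v)) (at (0, y))"
proof -
  have p: "(0, y) \<in> chart_dom" using y by (simp add: chart_dom_def)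
  show ?thesis
    unfolding metric_den1_def
    by (rule rho_derivative[OF p] rho1_derivative[OF p] derivative_eq_intros zero_neq_numeral[symmetric] | rule refl)+
       (auto simp: metric_den2_def fun_eq_iff field_simps inner_commute)
qed

lemma metric_num_derivative:
  assumes p: "p \<in> chart_dom"
  shows "((\<lambda>p. metric_num p w z) has_derivative (\<lambda>v. metric_num1 p v w z)) (at p)"
  unfolding metric_num_def
  by (rule rho1_derivative[OF p] derivative_eq_intros zero_neq_numeral[symmetric] | rule refl)+
     (auto simp: metric_num1_def fun_eq_iff field_simps)

lemma metric_num1_derivative:
  assumes y: "0 < y"
  shows "((\<lambda>p. metric_num1 p v w z) has_derivative (\<lambda>u. metric_num2 y u v w z)) (at (0, y))"
proof -
  have p: "(0, y) \<in> chart_dom" using y by (simp add: chart_dom_def)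
  show ?thesis
    unfolding metric_num1_def
    by (rule rho1_derivative[OF p] rho2_derivative[OF y] derivative_eq_intros zero_neq_numeral[symmetric] | rule refl)+
       (auto simp: metric_num2_def fun_eq_iff field_simps)
qed

definition hyperboloid_metric :: "'m::finite coords \<Rightarrow> 'm coords \<Rightarrow> 'm coords \<Rightarrow> real" where
  "hyperboloid_metric p w z = metric_num p w z / metric_den p"

definition hyperboloid_metric1 :: "'m::finite coords \<Rightarrow> 'm coords \<Rightarrow> 'm coords \<Rightarrow> 'm coords \<Rightarrow> real" where
  "hyperboloid_metric1 p v w z = metric_num1 p v w z / metric_den p - metric_num p w z * metric_den1 p v / (metric_den p)^2"

definition hyperboloid_metric2 :: "real \<Rightarrow> 'm::finite coords \<Rightarrow> 'm coords \<Rightarrow> 'm coords \<Rightarrow> 'm coords \<Rightarrow> real" where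
  "hyperboloid_metric2 y u v w z = metric_num2 y u v w z / metric_den ((0,y) :: 'm coords)
     - (metric_num1 ((0,y) :: 'm coords) v w z * metric_den1 ((0,y) :: 'm coords) u + metric_num1 ((0,y) :: 'm coords) u w z * metric_den1 ((0,y) :: 'm coords) v + metric_num ((0,y) :: 'm coords) w z * metric_den2 y u v)
        / (metric_den ((0,y) :: 'm coords))^2
     + 2 * metric_num ((0,y) :: 'm coords) w z * metric_den1 ((0,y) :: 'm coords) u * metric_den1 ((0,y) :: 'm coords) v / (metric_den ((0,y) :: 'm coords))^3"

lemma hyperboloid_metric_derivative:
  assumes p: "p \<in> chart_dom"
  shows "((\<lambda>p. hyperboloid_metric p w z) has_derivative (\<lambda>v. hyperboloid_metric1 p v w z)) (at p)"
  unfolding hyperboloid_metric_def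
  by (rule metric_num_derivative[OF p] metric_den_derivative[OF p] derivative_eq_intros zero_neq_numeral[symmetric] | rule refl)+
     (use metric_den_pos[OF p] in \<open>auto simp: hyperboloid_metric1_def fun_eq_iff field_simps power2_eq_square\<close>)

lemma hyperboloid_metric1_derivative:
  assumes y: "0 < y"
  shows "((\<lambda>p. hyperboloid_metric1 p v w z) has_derivative (\<lambda>u. hyperboloid_metric2 y u v w z)) (at (0, y))"
proof -
  have p: "(0, y) \<in> chart_dom" using y by (simp add: chart_dom_def)
  note nz = less_imp_neq[OF metric_den_pos[OF p], symmetric]
    less_imp_neq[OF zero_less_power[OF metric_den_pos[OF p]], symmetric]
  show ?thesis
    unfolding hyperboloid_metric1_def
    by (rule metric_num_derivative[OF p] metric_num1_derivative[OF y]
          metric_den_derivative[OF p] metric_den1_derivative[OF y] nz derivative_eq_intros zero_neq_numeral[symmetric] | rule refl)+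
       (use metric_den_pos[OF p] in
         \<open>auto simp: hyperboloid_metric2_def fun_eq_iff field_simps power2_eq_square power3_eq_cube\<close>)
qed

section \<open>Curvature along the vertical axis\<close>

lemma koszul_hyperboloid_metric:
  assumes g: "riemannian_metric_on chart_dom g" "\<forall>p\<in>chart_dom. g p = hyperboloid_metric p"
    and p: "p \<in> chart_dom"
  shows "koszul g p u v w = (hyperboloid_metric1 p u v w + hyperboloid_metric1 p v u w - hyperboloid_metric1 p w u v) / 2"
proof -
  have "((\<lambda>q. g q u v) has_derivative (\<lambda>w. hyperboloid_metric1 p w u v)) (at p)" for u v
    by (rule has_derivative_transform_within_open[OF hyperboloid_metric_derivative[OF p] metric_open[OF g(1)] p])
       (simp add: g(2))
  then have "frechet_derivative (\<lambda>q. g q u v) (at p) = (\<lambda>w. hyperboloid_metric1 p w u v)" for u v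
    by (rule frechet_derivative_at[symmetric])
  then show ?thesis unfolding koszul_def by simp
qed

lemma koszul_hyperboloid_metric_derivative:
  assumes g: "riemannian_metric_on chart_dom g" "\<forall>p\<in>chart_dom. g p = hyperboloid_metric p"
    and y: "0 < y"
  shows "frechet_derivative (\<lambda>q. koszul g q v w z) (at (0, y)) u =
    (hyperboloid_metric2 y u v w z + hyperboloid_metric2 y u w v z - hyperboloid_metric2 y u z v w) / 2"
proof -
  have "((\<lambda>p. (hyperboloid_metric1 p v w z + hyperboloid_metric1 p w v z - hyperboloid_metric1 p z v w) * (1 / 2)) has_derivative
     (\<lambda>u. (hyperboloid_metric2 y u v w z + hyperboloid_metric2 y u w v z - hyperboloid_metric2 y u z v w) * (1 / 2))) (at (0, y))"
    by (intro has_derivative_mult_left has_derivative_add has_derivative_diff hyperboloid_metric1_derivative[OF y])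
  then have "((\<lambda>p. koszul g p v w z) has_derivative
     (\<lambda>u. (hyperboloid_metric2 y u v w z + hyperboloid_metric2 y u w v z - hyperboloid_metric2 y u z v w) * (1 / 2))) (at (0, y))"
    by (rule has_derivative_transform_within_open[OF _ metric_open[OF g(1)]])
       (use y koszul_hyperboloid_metric[OF g] in \<open>auto simp: chart_dom_def\<close>)
  from fun_cong[OF frechet_derivative_at[OF this], of u] show ?thesis by simp
qed

lemma christoffel_eqI:
  assumes g: "riemannian_metric_on S g" and p: "p \<in> S" and z: "\<And>w. g p z w = koszul g p u v w"
  shows "christoffel g p u v = z"
proof (rule ccontr)
  assume "christoffel g p u v \<noteq> z"
  then have "0 < g p (christoffel g p u v - z) (christoffel g p u v - z)"
    using metric_pos[OF g p] by simp
  then show False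
    by (simp add: bilinear_lsub[OF metric_bilinear[OF g p]] z metric_christoffel[OF g p])
qed

lemma axis_values:
  assumes "0 < y"
  shows "rho (0, y) = 1 / y" "rho1 (0, y) w = - (snd w / y^2)"
    "rho2 (0, y) v w = 2 * (fst v \<bullet> fst w) / y + 2 * snd v * snd w / y^3"
    "metric_den ((0, y) :: 'm::finite coords) = (1 + y^4) / (2 * y^2)"
    "metric_num (0, y) w z = fst w \<bullet> fst z + snd w * snd z * (1 + y^4) / (2 * y^4)"
    "metric_den1 (0, y) v = snd v * (y^4 - 1) / y^3"
    "metric_num1 (0, y) v w z = - (((fst v \<bullet> fst w) * snd z + (fst v \<bullet> fst z) * snd w) / y^3
        + 2 * snd v * snd w * snd z / y^5)"
  using assms
  by (simp_all add: rho_def rho1_def rho2_def metric_den_def metric_num_def metric_den1_def metric_num1_def power_divide field_simps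
      flip: power_mult power_add) (simp_all add: power_numeral_reduce algebra_simps)

text \<open>By rotational symmetry about the axis only three coefficients occur: one for the products of a
  radial with an orthogonal component, and two in the radial part of the result. They are read off
  from the Koszul expression.\<close>

lemma christoffel_axis:
  fixes u v :: "'m::finite coords"
  assumes g: "riemannian_metric_on chart_dom g" "\<forall>p\<in>chart_dom. g p = hyperboloid_metric p"
    and y: "0 < y"
  shows "christoffel g (0, y) u v =
    ((- ((y^4 - 1) / (y * (1 + y^4)))) *\<^sub>R (snd u *\<^sub>R fst v + snd v *\<^sub>R fst u),
     2 * y * (y^2 * (y^4 - 1) - (1 + y^4)) / (1 + y^4)^2 * (fst u \<bullet> fst v) - snd u * snd v / y)"
proof (rule christoffel_eqI[OF g(1)])
  show p: "((0, y) :: 'm coords) \<in> chart_dom" using y by (simp add: chart_dom_def)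
  fix w :: "'m coords"
  define e where "e = 1 + y^4"
  have e: "e \<noteq> 0" "y \<noteq> 0" "y ^ 4 = e - 1" 
    using y zero_less_power[OF y, of 4] unfolding e_def by linarith+
  show "g (0, y) ((- ((y^4 - 1) / (y * (1 + y^4)))) *\<^sub>R (snd u *\<^sub>R fst v + snd v *\<^sub>R fst u),
     2 * y * (y^2 * (y^4 - 1) - (1 + y^4)) / (1 + y^4)^2 * (fst u \<bullet> fst v) - snd u * snd v / y) w
    = koszul g (0, y) u v w"
    unfolding koszul_hyperboloid_metric[OF g p]
    unfolding bspec[OF g(2) p] hyperboloid_metric_def hyperboloid_metric1_def axis_values[OF y]
      fst_conv snd_conv inner_add_left inner_scaleR_left inner_commute[of "fst w"] inner_commute[of "fst v" "fst u"] e_def[symmetric]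
    using e(1,2)
    by (simp add: divide_simps) (unfold e_def, algebra)
qed

text \<open>With all derivatives at \<open>(0, y)\<close> known this is an identity of rational functions in \<open>y\<close>, the
  radial components and the inner products of the orthogonal components. Writing \<open>e\<close> for \<open>1 + y^4\<close>
  keeps the denominators in factored form until they are cleared.\<close>

lemma curvature_axis:
  fixes u v :: "'m::finite coords"
  assumes g: "riemannian_metric_on chart_dom g" "\<forall>p\<in>chart_dom. g p = hyperboloid_metric p"
    and y: "0 < y"
  shows "g (0, y) (riemann_curvature g (0, y) u v v) u =
      2 * (1 + 2 * y^2 + 4 * y^4 + 2 * y^6 + y^8) / (1 + y^4)^2
        * (4 * y^4 * ((fst u \<bullet> fst u) * (fst v \<bullet> fst v) - (fst u \<bullet> fst v)^2) / (1 + y^4)^2)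
    + 4 * y^2 * (1 + 3 * y^2 + y^4) / (1 + y^4)^2
        * (2 * ((snd u)^2 * (fst v \<bullet> fst v) - 2 * snd u * snd v * (fst u \<bullet> fst v)
             + (snd v)^2 * (fst u \<bullet> fst u)) / (1 + y^4))"
proof -
  have p: "((0, y) :: 'm coords) \<in> chart_dom" using y by (simp add: chart_dom_def)
  define e where "e = 1 + y^4"
  have e: "e \<noteq> 0" "y \<noteq> 0" "y ^ 4 = e - 1"
    using y zero_less_power[OF y, of 4] unfolding e_def by linarith+
  obtain a b where u: "u = (a, b)" by (cases u)
  obtain a' b' where v: "v = (a', b')" by (cases v)
  show ?thesis
    unfolding metric_riemann_curvature[OF g(1) p]
    unfolding koszul_hyperboloid_metric_derivative[OF g y] christoffel_axis[OF g y]
    unfolding bspec[OF g(2) p] hyperboloid_metric_def hyperboloid_metric2_def metric_num2_def metric_den2_def rho3_def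
      axis_values[OF y] u v fst_conv snd_conv e_def[symmetric]
      inner_add_left inner_add_right inner_scaleR_left inner_scaleR_right inner_commute[of a' a]
    using e(1,2)
    by (simp add: divide_simps) (unfold e_def, algebra)
qed

section \<open>Sectional curvature and angle of a plane\<close>

text \<open>A plane contains a vector \<open>v\<close> orthogonal to the axis; \<open>u\<close> is the other direction of the plane,
  made orthogonal to \<open>v\<close>.\<close>

lemma plane_adapted_basis:
  fixes \<sigma> :: "('a::euclidean_space \<times> real) set"
  assumes \<sigma>: "subspace \<sigma>" "dim \<sigma> = 2"
  obtains u v where "span {u, v} = \<sigma>" "u \<noteq> 0" "snd v = 0" "fst v \<noteq> 0" "fst u \<bullet> fst v = 0"
proof -
  obtain B where B: "B \<subseteq> \<sigma>" "independent B" "\<sigma> \<subseteq> span B" "card B = 2"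
    using basis_exists[of \<sigma>] \<sigma>(2) by metis
  then obtain x z where xz: "B = {x, z}" "x \<noteq> z" by (meson card_2_iff)
  have span: "span {x, z} = \<sigma>"
    using B xz \<sigma>(1) by (metis span_minimal subset_antisym)
  have ne: "snd x *\<^sub>R z - snd z *\<^sub>R x \<noteq> 0" if "snd x \<noteq> 0"
  proof
    assume eq: "snd x *\<^sub>R z - snd z *\<^sub>R x = 0"
    have "z = (1 / snd x) *\<^sub>R (snd x *\<^sub>R z)" using that by simp
    also have "\<dots> = (1 / snd x) *\<^sub>R (snd z *\<^sub>R x)" using eq by simp
    finally have "z \<in> span {x}" by (metis insertI1 span_base span_scale)
    moreover have "independent (insert z {x})" using B(2) unfolding xz(1) by (metis insert_commute)
    ultimately show False using xz(2) by (simp add: independent_insert)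
  qed
  have "\<exists>v\<in>\<sigma>. v \<noteq> 0 \<and> snd v = 0"
  proof (cases "snd x = 0")
    case True
    have "x \<noteq> 0" using B(2) xz(1) dependent_zero[of B] by fastforce
    moreover have "x \<in> \<sigma>" using B(1) xz(1) by simp
    ultimately show ?thesis using True by metis
  next
    case False
    have "snd x *\<^sub>R z - snd z *\<^sub>R x \<in> \<sigma>"
      using B xz by (simp add: subspace_diff subspace_scale \<sigma>(1))
    then show ?thesis using ne[OF False] by (intro bexI[of _ "snd x *\<^sub>R z - snd z *\<^sub>R x"]) auto
  qed
  then obtain v where v: "v \<in> \<sigma>" "v \<noteq> 0" "snd v = 0" by blast
  have fv: "fst v \<noteq> 0" using v by (auto simp: prod_eq_iff)
  have "\<not> \<sigma> \<subseteq> span {v}"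
    using \<sigma>(2) dim_le_card[of \<sigma> "{v}"] by auto
  then obtain w where w: "w \<in> \<sigma>" "w \<notin> span {v}" by blast
  define u where "u = w - ((fst w \<bullet> fst v) / (fst v \<bullet> fst v)) *\<^sub>R v"
  have u: "u \<in> \<sigma>" using w(1) v(1) \<sigma>(1) by (simp add: u_def subspace_diff subspace_scale)
  have "u \<notin> span {v}"
    using w(2) unfolding u_def by (metis insertI1 span_add_eq span_base span_scale diff_add_cancel span_add)
  then have "independent {u, v}" "u \<noteq> v"
    using v(2) by (auto simp: independent_insert span_base)
  then have "span {u, v} = \<sigma>"
    using card_ge_dim_independent[of "{u, v}" \<sigma>] u v(1) \<sigma> by (simp add: span_minimal subset_antisym)
  moreover have "u \<noteq> 0" using \<open>u \<notin> span {v}\<close> span_zero by blast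
  moreover have "fst u \<bullet> fst v = 0" using fv by (simp add: u_def inner_diff_left)
  ultimately show ?thesis using that v(3) fv by blast
qed

text \<open>In the adapted basis \<open>u\<close>, \<open>v\<close> of the plane, a change of basis multiplies both the curvature term
  and the squared area by the square of its determinant \<open>d\<close>, so the quotient is well defined. The
  vector of the plane closest to the axis is \<open>u\<close> or \<open>- u\<close>, because adding multiples of \<open>v\<close> increases
  the length without changing the radial component. Hence \<open>cos\<^sup>2\<close> of the angle is the radial
  proportion \<open>\<beta> b\<^sup>2 / N\<close> of the squared length \<open>N\<close> of \<open>u\<close>.\<close>

lemma sectional_curvature_plane:
  fixes g :: "'a::euclidean_space \<times> real \<Rightarrow> 'a \<times> real \<Rightarrow> 'a \<times> real \<Rightarrow> real"
  assumes \<alpha>\<beta>: "0 < \<alpha>" "0 < \<beta>"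
    and g: "\<And>u v. g p u v = \<alpha> * (fst u \<bullet> fst v) + \<beta> * (snd u * snd v)"
    and R: "\<And>u v. g p (riemann_curvature g p u v v) u =
        Kt * (\<alpha>^2 * ((fst u \<bullet> fst u) * (fst v \<bullet> fst v) - (fst u \<bullet> fst v)^2))
      + Kr * (\<alpha> * \<beta> * ((snd u)^2 * (fst v \<bullet> fst v) - 2 * snd u * snd v * (fst u \<bullet> fst v)
             + (snd v)^2 * (fst u \<bullet> fst u)))"
    and \<sigma>: "subspace \<sigma>" "dim \<sigma> = 2"
  shows "sectional_curvature g p \<sigma> =
    (cos (subspace_angle g p \<sigma> (0, 1)))^2 * Kr + (sin (subspace_angle g p \<sigma> (0, 1)))^2 * Kt"
proof -
  obtain u v where uv: "span {u, v} = \<sigma>" "u \<noteq> 0" "snd v = 0" "fst v \<noteq> 0" "fst u \<bullet> fst v = 0"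
    using plane_adapted_basis[OF \<sigma>] .
  define A A' b N where "A = fst u \<bullet> fst u" and "A' = fst v \<bullet> fst v" and "b = snd u"
    and "N = \<alpha> * A + \<beta> * b^2"
  have A': "A' > 0" using uv(4) by (simp add: A'_def)
  have A: "A \<ge> 0" by (simp add: A_def)
  have N: "N > 0"
  proof (cases "b = 0")
    case True
    then have "fst u \<noteq> 0" using uv(2) by (auto simp: b_def prod_eq_iff)
    then show ?thesis using \<alpha>\<beta> by (simp add: N_def A_def True)
  next
    case False
    then show ?thesis using \<alpha>\<beta> A by (simp add: N_def add_nonneg_pos)
  qed
  have comb: "\<exists>s t. w = s *\<^sub>R u + t *\<^sub>R v" if "w \<in> \<sigma>" for w
    using that uv(1) by (auto simp: span_insert span_singleton algebra_simps)
  have vals: "fst (s *\<^sub>R u + t *\<^sub>R v) \<bullet> fst (s' *\<^sub>R u + t' *\<^sub>R v) = s * s' * A + t * t' * A'"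
    "snd (s *\<^sub>R u + t *\<^sub>R v) = s * b" for s t s' t'
    using uv(3,5) by (simp_all add: inner_add_left inner_add_right A_def A'_def b_def inner_commute algebra_simps)
  define \<kappa> where "\<kappa> = (Kt * (\<alpha> * A) + Kr * (\<beta> * b^2)) / N"
  have frac: "g p (riemann_curvature g p x z z) x / (g p x x * g p z z - (g p x z)^2) = \<kappa>"
    if xz: "span {x, z} = \<sigma>" for x z
  proof -
    have "x \<in> \<sigma>" "z \<in> \<sigma>" using xz by (auto simp: span_base)
    then obtain s t s' t' where x: "x = s *\<^sub>R u + t *\<^sub>R v" and z: "z = s' *\<^sub>R u + t' *\<^sub>R v"
      using comb by metis
    define d where "d = s * t' - t * s'"
    have "d \<noteq> 0"
    proof
      assume d: "d = 0"
      have e1: "t' *\<^sub>R x = t *\<^sub>R z" and e2: "s' *\<^sub>R x = s *\<^sub>R z"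
        using d by (simp_all add: x z d_def algebra_simps)
      have "\<exists>w. x \<in> span {w} \<and> z \<in> span {w}"
      proof (cases "s' = 0 \<and> t' = 0")
        case True
        then show ?thesis by (intro exI[of _ x]) (auto simp: z span_base span_zero)
      next
        case False
        then have "x = (t / t') *\<^sub>R z \<or> x = (s / s') *\<^sub>R z"
          using e1 e2 by (metis divide_inverse_commute scaleR_one left_inverse scaleR_scaleR)
        then have "x \<in> span {z}" by (metis insertI1 span_base span_scale)
        then show ?thesis by (intro exI[of _ z]) (auto simp: span_base)
      qed
      then obtain w where "{x, z} \<subseteq> span {w}" by auto
      then have "dim \<sigma> \<le> card {w}"
        using span_minimal[OF _ subspace_span] xz by (intro dim_le_card) blast+
      then show False using \<sigma>(2) by simp
    qed
    have den: "g p x x * g p z z - (g p x z)^2 = d^2 * (N * (\<alpha> * A'))"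
      unfolding g x z vals d_def N_def by algebra
    have num: "g p (riemann_curvature g p x z z) x = d^2 * ((Kt * (\<alpha> * A) + Kr * (\<beta> * b^2)) * (\<alpha> * A'))"
      unfolding R unfolding x z vals d_def by algebra
    show ?thesis
      unfolding den num \<kappa>_def using \<open>d \<noteq> 0\<close> N A' \<alpha>\<beta> by simp
  qed
  have sec: "sectional_curvature g p \<sigma> = \<kappa>"
    unfolding sectional_curvature_def
    by (rule the_equality) (use uv(1) frac in blast)+
  \<comment> \<open>the cosine of the angle between \<open>u\<close> or \<open>- u\<close> and the axis\<close>
  define c where "c = sqrt \<beta> * \<bar>b\<bar> / sqrt N"
  have c2: "c^2 = \<beta> * b^2 / N" using \<alpha>\<beta> N by (simp add: c_def power_divide power_mult_distrib)
  have c01: "0 \<le> c" "c \<le> 1"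
  proof -
    show "0 \<le> c" using \<alpha>\<beta> N by (simp add: c_def)
    have "c^2 \<le> 1" unfolding c2 using N A \<alpha>\<beta> by (simp add: N_def)
    then show "c \<le> 1" by (simp add: power_le_one_iff abs_square_le_1)
  qed
  have ang: "metric_angle g p (s *\<^sub>R u + t *\<^sub>R v) (0, 1) =
      arccos (sqrt \<beta> * (s * b) / sqrt (s^2 * N + t^2 * (\<alpha> * A')))" for s t
  proof -
    have 1: "g p (s *\<^sub>R u + t *\<^sub>R v) (s *\<^sub>R u + t *\<^sub>R v) = s^2 * N + t^2 * (\<alpha> * A')"
      unfolding g vals N_def by algebra
    have 2: "g p (s *\<^sub>R u + t *\<^sub>R v) (0, 1) = sqrt \<beta> * (s * b) * sqrt \<beta>"
      unfolding g vals using \<alpha>\<beta> by simp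
    have 3: "g p (0, 1) (0, 1) = \<beta>" unfolding g by simp
    have "sqrt \<beta> \<noteq> 0" using \<alpha>\<beta> by simp
    then show ?thesis
      unfolding metric_angle_def 1 2 3 by (simp only: nonzero_mult_divide_mult_cancel_right not_False_eq_True)
  qed
  have "subspace_angle g p \<sigma> (0, 1) = arccos c"
    unfolding subspace_angle_def
  proof (rule cInf_eq_minimum)
    define s where "s = (if b \<ge> 0 then 1 else -1 :: real)"
    have "arccos c = metric_angle g p (s *\<^sub>R u + 0 *\<^sub>R v) (0, 1)"
      unfolding ang c_def s_def by (auto simp: abs_if)
    moreover have "s *\<^sub>R u + 0 *\<^sub>R v \<in> \<sigma> - {0}"
      using uv(1,2) by (auto simp: s_def span_base span_neg)
    ultimately show "arccos c \<in> (\<lambda>u. metric_angle g p u (0, 1)) ` (\<sigma> - {0})" by blast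
  next
    fix a assume "a \<in> (\<lambda>u. metric_angle g p u (0, 1)) ` (\<sigma> - {0})"
    then obtain w where w: "w \<in> \<sigma>" "w \<noteq> 0" "a = metric_angle g p w (0, 1)" by blast
    obtain s t where st: "w = s *\<^sub>R u + t *\<^sub>R v" using comb[OF w(1)] by blast
    let ?q = "sqrt \<beta> * (s * b) / sqrt (s^2 * N + t^2 * (\<alpha> * A'))"
    have "\<bar>?q\<bar> \<le> c"
    proof (cases "s = 0")
      case True
      then show ?thesis using c01 by simp
    next
      case False
      have "\<bar>?q\<bar> = sqrt \<beta> * (\<bar>s\<bar> * \<bar>b\<bar>) / sqrt (s^2 * N + t^2 * (\<alpha> * A'))"
        using \<alpha>\<beta> N A' by (simp add: abs_mult)
      also have "\<dots> \<le> sqrt \<beta> * (\<bar>s\<bar> * \<bar>b\<bar>) / sqrt (s^2 * N)"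
        using \<alpha>\<beta> N A' False by (intro divide_left_mono) (auto intro!: mult_pos_pos add_pos_nonneg)
      also have "\<dots> = c" using False by (simp add: c_def real_sqrt_mult)
      finally show ?thesis .
    qed
    then show "arccos c \<le> a"
      unfolding w(3) st ang using c01 by (intro arccos_le_arccos) linarith+
  qed
  then have cos: "cos (subspace_angle g p \<sigma> (0, 1)) = c" using c01 by (simp add: cos_arccos)
  have sin: "(sin (subspace_angle g p \<sigma> (0, 1)))^2 = \<alpha> * A / N"
    unfolding sin_squared_eq cos c2 using N by (simp add: field_simps N_def)
  show ?thesis
    unfolding sec sin cos c2 \<kappa>_def by (simp add: add_divide_distrib mult.commute add.commute)
qed

section \<open>The curvature of the quotient\<close>

lemma quotient_metric_eq:
  fixes g :: "'m::{finite,linorder} coords \<Rightarrow> 'm coords \<Rightarrow> 'm coords \<Rightarrow> real"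
  assumes "is_quotient_metric g"
  shows "\<forall>p\<in>chart_dom. g p = hyperboloid_metric p"
  using quotient_metric_formula assms
  by (auto simp: is_quotient_metric_def fun_eq_iff hyperboloid_metric_def metric_num_def metric_den_def inner_hyperboloid inner_hyperboloid_deriv)

text \<open>The sectional curvatures of the planes that contain the radial direction and of those orthogonal
  to it.\<close>

definition kappa_rad :: "real \<Rightarrow> real" where
  "kappa_rad y = 4 * y^2 * (1 + 3 * y^2 + y^4) / (1 + y^4)^2"

definition kappa_tan :: "real \<Rightarrow> real" where
  "kappa_tan y = 2 * (1 + 2 * y^2 + 4 * y^4 + 2 * y^6 + y^8) / (1 + y^4)^2"

lemma sectional_curvature_axis:
  fixes g :: "'m::{finite,linorder} coords \<Rightarrow> 'm coords \<Rightarrow> 'm coords \<Rightarrow> real"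
  assumes g: "is_quotient_metric g" and y: "0 < y" and \<sigma>: "subspace \<sigma>" "dim \<sigma> = 2"
  shows "sectional_curvature g (0, y) \<sigma> =
    (cos (subspace_angle g (0, y) \<sigma> (0, 1)))^2 * kappa_rad y
    + (sin (subspace_angle g (0, y) \<sigma> (0, 1)))^2 * kappa_tan y"
proof (rule sectional_curvature_plane[where \<alpha> = "2 * y^2 / (1 + y^4)" and \<beta> = "1 / y^2", OF _ _ _ _ \<sigma>])
  have p: "((0, y) :: 'm coords) \<in> chart_dom" using y by (simp add: chart_dom_def)
  have g1: "riemannian_metric_on chart_dom g" using g by (simp add: is_quotient_metric_def)
  note g2 = quotient_metric_eq[OF g]
  define e where "e = 1 + y^4"
  have e: "e > 0" using zero_less_power[OF y, of 4] unfolding e_def by linarith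
  show "0 < 2 * y^2 / (1 + y^4)" "0 < 1 / y^2" 
    unfolding e_def[symmetric] using y e by simp_all
  show "g (0, y) u v = 2 * y^2 / (1 + y^4) * (fst u \<bullet> fst v) + 1 / y^2 * (snd u * snd v)" for u v
    unfolding bspec[OF g2 p] hyperboloid_metric_def axis_values[OF y] e_def[symmetric]
    using y e by (simp add: field_simps power2_eq_square power4_eq_xxxx)
  show "g (0, y) (riemann_curvature g (0, y) u v v) u =
      kappa_tan y * ((2 * y^2 / (1 + y^4))^2 * ((fst u \<bullet> fst u) * (fst v \<bullet> fst v) - (fst u \<bullet> fst v)^2))
    + kappa_rad y * (2 * y^2 / (1 + y^4) * (1 / y^2) * ((snd u)^2 * (fst v \<bullet> fst v)
        - 2 * snd u * snd v * (fst u \<bullet> fst v) + (snd v)^2 * (fst u \<bullet> fst u)))" for u v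
  proof -
    have 1: "(2 * y^2 / (1 + y^4))^2 * x = 4 * y^4 * x / (1 + y^4)^2" for x
      by (simp add: power_divide power_mult_distrib flip: power_mult)
    have 2: "2 * y^2 / (1 + y^4) * (1 / y^2) * x = 2 * x / (1 + y^4)" for x
      using y by simp
    show ?thesis
      unfolding curvature_axis[OF g1 g2 y] kappa_tan_def kappa_rad_def 1 2 ..
  qed
qed

text \<open>With \<open>t = y\<^sup>2\<close> both inequalities with \<open>5\<close> reduce to the nonnegativity of \<open>(t - 1)\<^sup>2\<close> times a
  quadratic polynomial with positive coefficients.\<close>

lemma kappa_bounds:
  assumes "0 < y"
  shows "0 < kappa_rad y" "kappa_rad y \<le> 5" "0 < kappa_tan y" "kappa_tan y \<le> 5"
proof -
  define t where "t = y^2"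
  have t: "0 < t" using assms by (simp add: t_def)
  have p: "y^4 = t^2" "y^6 = t^3" "y^8 = t^4" by (simp_all add: t_def flip: power_mult)
  have "0 < 1 + t^2" by (simp add: add_pos_nonneg)
  then have e: "0 < (1 + t^2)^2" by simp
  have r: "kappa_rad y = 4 * t * (1 + 3 * t + t^2) / (1 + t^2)^2"
    unfolding kappa_rad_def p by (simp add: t_def)
  have s: "kappa_tan y = 2 * (1 + 2 * t + 4 * t^2 + 2 * t^3 + t^4) / (1 + t^2)^2"
    unfolding kappa_tan_def p by (simp add: t_def)
  show "0 < kappa_rad y" "0 < kappa_tan y"
    unfolding r s using t e by (simp_all add: add_pos_pos)
  have "0 \<le> (t - 1)^2 * (5 * t^2 + 6 * t + 5)" "0 \<le> (t - 1)^2 * (3 * t^2 + 2 * t + 3)"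
    using t by simp_all
  moreover have "(t - 1)^2 * (5 * t^2 + 6 * t + 5) = 5 * (1 + t^2)^2 - 4 * t * (1 + 3 * t + t^2)"
    "(t - 1)^2 * (3 * t^2 + 2 * t + 3) = 5 * (1 + t^2)^2 - 2 * (1 + 2 * t + 4 * t^2 + 2 * t^3 + t^4)"
    by algebra+
  ultimately show "kappa_rad y \<le> 5" "kappa_tan y \<le> 5"
    unfolding r s pos_divide_le_eq[OF e] by linarith+
qed

theorem theorem4p15:
  fixes g :: "'m::{finite,linorder} coords \<Rightarrow> 'm coords \<Rightarrow> 'm coords \<Rightarrow> real"
  assumes "is_quotient_metric g"
  shows "(\<forall>y \<theta> \<sigma>. 1 \<le> y \<and> subspace \<sigma> \<and> dim \<sigma> = 2 \<and> subspace_angle g (0, y) \<sigma> (0, 1) = \<theta> \<longrightarrow>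
            sectional_curvature g (0, y) \<sigma> =
              (cos \<theta>)\<^sup>2 * (4 * y^2 * (1 + 3 * y^2 + y^4) / (1 + y^4)^2)
            + (sin \<theta>)\<^sup>2 * (2 * (1 + 2 * y^2 + 4 * y^4 + 2 * y^6 + y^8) / (1 + y^4)^2))
       \<and> (\<forall>y \<sigma>. 1 \<le> y \<and> subspace \<sigma> \<and> dim \<sigma> = 2 \<longrightarrow>
            0 < sectional_curvature g (0, y) \<sigma> \<and> sectional_curvature g (0, y) \<sigma> \<le> 5)
       \<and> (\<forall>\<sigma>. subspace \<sigma> \<and> dim \<sigma> = 2 \<longrightarrow>
            sectional_curvature g (0, 1) \<sigma> = 5 \<and>
            (\<forall>y \<tau>. 1 \<le> y \<and> subspace \<tau> \<and> dim \<tau> = 2 \<longrightarrow>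
               sectional_curvature g (0, y) \<tau> \<le> sectional_curvature g (0, 1) \<sigma>))"
proof -
  let ?K = "sectional_curvature g"
  have 1: "?K (0, y) \<sigma> =
      (cos (subspace_angle g (0, y) \<sigma> (0, 1)))^2 * kappa_rad y
      + (sin (subspace_angle g (0, y) \<sigma> (0, 1)))^2 * kappa_tan y"
    if "1 \<le> y" "subspace \<sigma>" "dim \<sigma> = 2" for y \<sigma>
    using sectional_curvature_axis[OF assms] that by simp
  have 2: "0 < ?K (0, y) \<sigma>" "?K (0, y) \<sigma> \<le> 5" if "1 \<le> y" "subspace \<sigma>" "dim \<sigma> = 2" for y \<sigma>
  proof -
    define c where "c = (cos (subspace_angle g (0, y) \<sigma> (0, 1)))^2"
    have c: "0 \<le> c" "c \<le> 1" by (simp_all add: c_def abs_square_le_1)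
    have K: "?K (0, y) \<sigma> = c * kappa_rad y + (1 - c) * kappa_tan y"
      unfolding 1[OF that] by (simp add: c_def sin_squared_eq)
    have b: "0 < kappa_rad y" "kappa_rad y \<le> 5" "0 < kappa_tan y" "kappa_tan y \<le> 5"
      using kappa_bounds[of y] that(1) by auto
    have "c * kappa_rad y + (1 - c) * kappa_tan y \<le> c * 5 + (1 - c) * 5"
      by (intro add_mono mult_left_mono) (use b c in simp_all)
    then show "?K (0, y) \<sigma> \<le> 5" unfolding K by simp
    show "0 < ?K (0, y) \<sigma>"
      unfolding K using b c by (cases "c = 0") (auto intro!: add_pos_nonneg)
  qed
  have 3: "?K (0, 1) \<sigma> = 5" if "subspace \<sigma>" "dim \<sigma> = 2" for \<sigma>
    using 1[of 1 \<sigma>] that by (simp add: kappa_rad_def kappa_tan_def flip: distrib_right)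
  show ?thesis
    using 1 2 3 by (auto simp: kappa_rad_def kappa_tan_def)
qed

end
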